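(* Let $d$ be the degree sequence of a graph. The realization graph $\mathscr{G}(d)$ is a hypercube if and only if $d$ is the degree sequence of a graph that is both split and $P_4$-reducible.
   Context: All graphs are finite and simple. For a degree sequence $d=(d_1,\dots,d_n)$, a realization of $d$ is a graph with vertex set $\{1,\dots,n\}$ in which vertex $i$ has degree $d_i$ (realizations are distinguished by edge sets). A 2-switch replaces edges $ab,cd$ by $ad,bc$, where $a,b,c,d$ are distinct vertices, $ab,cd$ are edges and $ad,bc$ are non-edges. The realization graph $\mathscr{G}(d)$ has the realizations of $d$ as vertices, two being adjacent iff one is obtained from the other by a single 2-switch. A hypercube is a graph whose vertices can be identified with all $(0,1)$-vectors of some fixed length $m\ge 0$ so that two vertices are adjacent iff their vectors differ in exactly one coordinate (so $K_1$ and $K_2$ are hypercubes). A split graph is a graph whose vertex set can be partitioned into a clique and an independent set. A graph is $P_4$-reducible if each of its vertices belongs to at most one induced path on four vertices. *)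

theory Defs
  imports "HOL-Library.Ramsey"
begin

text \<open>
  A finite simple graph is given by a vertex set \<open>V\<close> and an edge set \<open>E \<subseteq> [V]\<^bsup>2\<^esup>\<close> consisting of
  two-element subsets of \<open>V\<close>.
\<close>

definition simple_graph :: "'a set \<Rightarrow> 'a set set \<Rightarrow> bool" where
  "simple_graph V E \<longleftrightarrow> finite V \<and> E \<subseteq> [V]\<^bsup>2\<^esup>"

definition degree :: "'a set set \<Rightarrow> 'a \<Rightarrow> nat" where
  "degree E v = card {e \<in> E. v \<in> e}"

text \<open>
  A sequence \<open>(d\<^sub>1, \<dots>, d\<^sub>n)\<close> is a list of length \<open>n\<close>; list positions start at \<open>0\<close>, so \<open>d\<^sub>i\<close> is
  \<open>d ! (i - 1)\<close>.
\<close>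

definition seq_verts :: "nat list \<Rightarrow> nat set" where
  "seq_verts d = {1..length d}"

definition realizations :: "nat list \<Rightarrow> nat set set set" where
  "realizations d =
     {E. simple_graph (seq_verts d) E \<and> (\<forall>i\<in>seq_verts d. degree E i = d ! (i - 1))}"

definition two_switch :: "'a set set \<Rightarrow> 'a set set \<Rightarrow> bool" where
  "two_switch E F \<longleftrightarrow>
     (\<exists>a b c d. distinct [a, b, c, d] \<and>
        {a, b} \<in> E \<and> {c, d} \<in> E \<and> {a, d} \<notin> E \<and> {b, c} \<notin> E \<and>
        F = (E - {{a, b}, {c, d}}) \<union> {{a, d}, {b, c}})"

text \<open>
  The realization graph has vertex set \<open>realizations d\<close> and the following edge set.
\<close>

definition realization_graph_edges :: "nat list \<Rightarrow> nat set set set set" where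
  "realization_graph_edges d =
     {{E, F} | E F. E \<in> realizations d \<and> F \<in> realizations d \<and> (two_switch E F \<or> two_switch F E)}"

definition hypercube :: "'a set \<Rightarrow> 'a set set \<Rightarrow> bool" where
  "hypercube V E \<longleftrightarrow>
     (\<exists>m f. bij_betw f V {xs :: bool list. length xs = m} \<and>
        (\<forall>x\<in>V. \<forall>y\<in>V. {x, y} \<in> E \<longleftrightarrow> card {i. i < m \<and> f x ! i \<noteq> f y ! i} = 1))"

definition split_graph :: "'a set \<Rightarrow> 'a set set \<Rightarrow> bool" where
  "split_graph V E \<longleftrightarrow> (\<exists>K I. K \<union> I = V \<and> K \<inter> I = {} \<and> clique K E \<and> indep I E)"

text \<open>
  An induced subgraph is determined by its vertex set, so induced paths on four vertices are
  counted by their vertex sets.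
\<close>

definition induced_P4 :: "'a set \<Rightarrow> 'a set set \<Rightarrow> 'a set \<Rightarrow> bool" where
  "induced_P4 V E S \<longleftrightarrow>
     (\<exists>a b c d. distinct [a, b, c, d] \<and> S = {a, b, c, d} \<and> S \<subseteq> V \<and>
        {a, b} \<in> E \<and> {b, c} \<in> E \<and> {c, d} \<in> E \<and>
        {a, c} \<notin> E \<and> {a, d} \<notin> E \<and> {b, d} \<notin> E)"

definition P4_reducible :: "'a set \<Rightarrow> 'a set set \<Rightarrow> bool" where
  "P4_reducible V E \<longleftrightarrow>
     (\<forall>v\<in>V. \<forall>S T. induced_P4 V E S \<and> v \<in> S \<and> induced_P4 V E T \<and> v \<in> T \<longrightarrow> S = T)"

end

theory Submission
  imports Defs
begin

text \<open>
  A hypercube contains neither a triangle nor a \<open>K\<^sub>2\<^sub>,\<^sub>3\<close>. Induced \<open>2K\<^sub>2\<close> and \<open>C\<^sub>4\<close>, as well as two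
  vertices \<open>p, q\<close> with two private neighbours of \<open>p\<close> and one of \<open>q\<close>, produce triangles in the realization
  graph. An induced \<open>C\<^sub>5\<close>, a \<open>3 \<times> 3\<close> identity pattern and its complement produce a \<open>K\<^sub>2\<^sub>,\<^sub>3\<close>. A graph
  without \<open>2K\<^sub>2\<close>, \<open>C\<^sub>4\<close>, \<open>C\<^sub>5\<close> is split, and two induced paths on four vertices sharing a vertex of a
  split graph force one of the remaining patterns.

  Conversely, let \<open>E\<close> be split and \<open>P\<^sub>4\<close>-reducible. Switching an induced \<open>P\<^sub>4\<close> exchanges its two
  endpoints, so it preserves the family of induced \<open>P\<^sub>4\<close>s. Whenever a realization differs from \<open>E\<close>, some
  such switch brings \<open>E\<close> closer to it. Hence all realizations have the same pairwise
  disjoint induced \<open>P\<^sub>4\<close>s, and a realization is determined by which of them are switched.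
\<close>

section \<open>Degrees and 2-switches\<close>

definition nbrs :: "'a set set \<Rightarrow> 'a \<Rightarrow> 'a set" where
  "nbrs E v = {w. {v, w} \<in> E}"

text \<open>The development works over arbitrary vertices and a degree function, free of list
  positions; \<open>realizations d\<close> is the instance with
  \<open>g i = d ! (i - 1)\<close>.\<close>

definition graphs_with_degrees :: "'a set \<Rightarrow> ('a \<Rightarrow> nat) \<Rightarrow> 'a set set set" where
  "graphs_with_degrees V g = {E. simple_graph V E \<and> (\<forall>v\<in>V. degree E v = g v)}"

definition switch_edges :: "'a set set set \<Rightarrow> 'a set set set set" where
  "switch_edges R = {{E, F} | E F. E \<in> R \<and> F \<in> R \<and> (two_switch E F \<or> two_switch F E)}"

lemma in_nbrs_iff [simp]: "w \<in> nbrs E v \<longleftrightarrow> {v, w} \<in> E"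
  by (simp add: nbrs_def)

lemma simple_graph_edgeD:
  assumes "simple_graph V E" "{v, w} \<in> E"
  shows "v \<in> V" "w \<in> V" "v \<noteq> w"
proof -
  have *: "{v, w} \<subseteq> V" "card {v, w} = 2"
    using assms unfolding simple_graph_def nsets_def by blast+
  show "v \<in> V" "w \<in> V" using *(1) by blast+
  show "v \<noteq> w"
  proof
    assume "v = w"
    then show False using *(2) by simp
  qed
qed

lemma nbrs_subset: "simple_graph V E \<Longrightarrow> nbrs E v \<subseteq> V - {v}"
  by (auto simp: nbrs_def dest: simple_graph_edgeD)

lemma finite_nbrs: "simple_graph V E \<Longrightarrow> finite (nbrs E v)"
  using nbrs_subset[of V E v] by (meson finite_Diff finite_subset simple_graph_def)

lemma degree_eq_card_nbrs:
  assumes "simple_graph V E"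
  shows "degree E v = card (nbrs E v)"
proof -
  have *: "\<exists>w. e = {v, w}" if "e \<in> E" "v \<in> e" for e
  proof -
    have "card e = 2" using assms that(1) unfolding simple_graph_def nsets_def by blast
    then obtain p q where "e = {p, q}" unfolding card_2_iff by blast
    then show ?thesis using that(2) by blast
  qed
  have "{e \<in> E. v \<in> e} = (\<lambda>w. {v, w}) ` nbrs E v"
  proof (intro subset_antisym subsetI)
    fix e assume "e \<in> {e \<in> E. v \<in> e}"
    then obtain w where "e = {v, w}" "e \<in> E" using * by blast
    then show "e \<in> (\<lambda>w. {v, w}) ` nbrs E v" by simp
  qed auto
  moreover have "inj_on (\<lambda>w. {v, w}) (nbrs E v)"
    by (rule inj_onI) (auto simp: doubleton_eq_iff)
  ultimately show ?thesis unfolding degree_def by (simp add: card_image)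
qed

section \<open>Two-switches as symmetric differences, and their effect on degrees\<close>

lemma two_switchI:
  assumes "distinct [a, b, c, d]" "{a, b} \<in> E" "{c, d} \<in> E" "{a, d} \<notin> E" "{b, c} \<notin> E"
    and "F = (E - {{a, b}, {c, d}}) \<union> {{a, d}, {b, c}}"
  shows "two_switch E F"
  using assms unfolding two_switch_def by blast

text \<open>Successive switches compose by \<open>flip_flip\<close>, so each graph reached in the
  pattern arguments below is written as \<open>flip E S\<close> with an explicit finite
  \<open>S\<close>.\<close>

definition flip :: "'b set \<Rightarrow> 'b set \<Rightarrow> 'b set" where
  "flip A S = sym_diff A S"

lemma in_flip [simp]: "e \<in> flip A S \<longleftrightarrow> (e \<in> A) \<noteq> (e \<in> S)"
  by (auto simp: flip_def)

lemma flip_flip: "flip (flip A S) T = flip A (flip S T)"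
  by (auto simp: flip_def)

lemma flip_empty [simp]: "flip A {} = A" "flip {} A = A"
  by (auto simp: flip_def)

lemma flip_cancel [simp]: "flip A S = flip A T \<longleftrightarrow> S = T"
  by (auto simp: flip_def)

lemma flip_eqI:
  assumes "\<forall>e\<in>S \<union> F \<union> T. e \<in> T \<longleftrightarrow> (e \<in> S) \<noteq> (e \<in> F)"
  shows "flip S F = T"
  using assms by (auto simp: flip_def)

text \<open>The four pairs are variables of their own, so that an edge can be named in the
  orientation in which the available facts mention it.\<close>

lemma two_switch_flipI:
  assumes "distinct [a, b, c, d]" "P = {a, b}" "Q = {c, d}" "X = {a, d}" "Y = {b, c}"
    and "P \<in> flip E S" "Q \<in> flip E S" "X \<notin> flip E S" "Y \<notin> flip E S"
    and "flip S {P, Q, X, Y} = T"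
  shows "two_switch (flip E S) (flip E T)"
proof (rule two_switchI[OF assms(1)])
  have "flip E T = flip (flip E S) {P, Q, X, Y}" using assms(10) by (simp add: flip_flip)
  also have "\<dots> = flip E S - {P, Q} \<union> {X, Y}" using assms(6-9) unfolding flip_def by blast
  finally show "flip E T = flip E S - {{a, b}, {c, d}} \<union> {{a, d}, {b, c}}" using assms(2-5) by simp
qed (use assms in auto)

lemma two_switch_flip0I:
  assumes "distinct [a, b, c, d]" "P = {a, b}" "Q = {c, d}" "X = {a, d}" "Y = {b, c}"
    and "P \<in> E" "Q \<in> E" "X \<notin> E" "Y \<notin> E"
  shows "two_switch E (flip E {P, Q, X, Y})"
  using two_switch_flipI[of a b c d P Q X Y E "{}"] assms by simp

lemma exchange_back:
  assumes "p \<in> A" "q \<in> A" "r \<notin> A" "s \<notin> A" "B = A - {p, q} \<union> {r, s}"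
  shows "r \<in> B" "s \<in> B" "p \<notin> B" "q \<notin> B" "A = B - {r, s} \<union> {p, q}"
  using assms by auto

text \<open>The quadruple \<open>a, d, c, b\<close> undoes the switch on
  \<open>a, b, c, d\<close>.\<close>

lemma two_switch_sym:
  assumes "two_switch E F"
  shows "two_switch F E"
proof -
  obtain a b c d where *: "distinct [a, b, c, d]" "{a, b} \<in> E" "{c, d} \<in> E" "{a, d} \<notin> E" "{b, c} \<notin> E"
    "F = (E - {{a, b}, {c, d}}) \<union> {{a, d}, {b, c}}"
    using assms unfolding two_switch_def by blast
  have rev: "{c, b} = {b, c}" "{d, c} = {c, d}" by auto
  show ?thesis
  proof (rule two_switchI[of a d c b])
    show "distinct [a, d, c, b]" using *(1) by auto
  qed (use exchange_back[OF *(2-6)] in \<open>simp_all only: rev not_False_eq_True\<close>)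
qed

lemma switch_edges_iff:
  assumes "E \<in> R" "F \<in> R"
  shows "{E, F} \<in> switch_edges R \<longleftrightarrow> two_switch E F"
proof
  assume "{E, F} \<in> switch_edges R"
  then obtain E' F' where *: "{E, F} = {E', F'}" "two_switch E' F' \<or> two_switch F' E'"
    unfolding switch_edges_def mem_Collect_eq by (elim exE conjE)
  from *(1) have "E = E' \<and> F = F' \<or> E = F' \<and> F = E'" by (simp only: doubleton_eq_iff)
  then show "two_switch E F" using *(2) two_switch_sym[of E F] two_switch_sym[of F E] by metis
next
  assume "two_switch E F"
  then show "{E, F} \<in> switch_edges R"
    using assms unfolding switch_edges_def mem_Collect_eq
    by (intro exI[of _ E] exI[of _ F] conjI refl disjI1)
qed

lemma card_exchange:
  assumes "finite A" "p \<in> A" "\<phi> p" "\<not> \<phi> q" "r \<notin> A" "\<phi> r" "\<not> \<phi> s"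
  shows "card {e \<in> A - {p, q} \<union> {r, s}. \<phi> e} = card {e \<in> A. \<phi> e}"
proof -
  have "{e \<in> A - {p, q} \<union> {r, s}. \<phi> e} = insert r ({e \<in> A. \<phi> e} - {p})"
    using assms by auto
  then show ?thesis
    using assms card.remove[of "{e \<in> A. \<phi> e}" p] by simp
qed

lemma degree_exchange:
  assumes "finite E" "p \<in> E" "v \<in> p" "v \<notin> q" "r \<notin> E" "v \<in> r" "v \<notin> s"
  shows "degree (E - {p, q} \<union> {r, s}) v = degree E v"
  unfolding degree_def by (rule card_exchange) (use assms in simp_all)

text \<open>Each of the four vertices lies in one removed and one added edge. Where necessary,
  \<open>F\<close> is reordered so that these two take the positions \<open>p\<close> and
  \<open>r\<close> of \<open>degree_exchange\<close>.\<close>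

lemma two_switch_degree:
  assumes "finite E" "two_switch E F"
  shows "degree F v = degree E v"
proof -
  obtain a b c d where *: "distinct [a, b, c, d]" "{a, b} \<in> E" "{c, d} \<in> E" "{a, d} \<notin> E" "{b, c} \<notin> E"
    "F = (E - {{a, b}, {c, d}}) \<union> {{a, d}, {b, c}}"
    using assms unfolding two_switch_def by blast
  consider "v \<notin> {a, b, c, d}" | "v = a" | "v = b" | "v = c" | "v = d" by blast
  then show ?thesis
  proof cases
    case 1
    then have "{e \<in> F. v \<in> e} = {e \<in> E. v \<in> e}" using * by auto
    then show ?thesis by (simp add: degree_def)
  next
    case 2
    show ?thesis unfolding *(6) by (rule degree_exchange) (use * assms(1) 2 in simp_all)
  next
    case 3
    have "F = E - {{a, b}, {c, d}} \<union> {{b, c}, {a, d}}" unfolding *(6) by blast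
    then show ?thesis
      by (simp only:) (rule degree_exchange; use *(1-5) assms(1) 3 in auto)
  next
    case 4
    have "F = E - {{c, d}, {a, b}} \<union> {{b, c}, {a, d}}" unfolding *(6) by blast
    then show ?thesis
      by (simp only:) (rule degree_exchange; use *(1-5) assms(1) 4 in auto)
  next
    case 5
    have "F = E - {{c, d}, {a, b}} \<union> {{a, d}, {b, c}}" unfolding *(6) by blast
    then show ?thesis
      by (simp only:) (rule degree_exchange; use *(1-5) assms(1) 5 in auto)
  qed
qed

lemma finite_edges: "simple_graph V E \<Longrightarrow> finite E"
  unfolding simple_graph_def using finite_imp_finite_nsets finite_subset by blast

lemma two_switch_simple_graph:
  assumes "simple_graph V E" "two_switch E F"
  shows "simple_graph V F"
proof -
  obtain a b c d where *: "distinct [a, b, c, d]" "{a, b} \<in> E" "{c, d} \<in> E"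
    "F = (E - {{a, b}, {c, d}}) \<union> {{a, d}, {b, c}}"
    using assms unfolding two_switch_def by blast
  have "a \<in> V" "b \<in> V" "c \<in> V" "d \<in> V" using * assms(1) by (auto dest: simple_graph_edgeD)
  then have "{a, d} \<in> [V]\<^bsup>2\<^esup>" "{b, c} \<in> [V]\<^bsup>2\<^esup>" using *(1) by (auto simp: nsets_def)
  then show ?thesis using assms(1) unfolding simple_graph_def *(4) by blast
qed

lemma two_switch_graphs_with_degrees:
  assumes "E \<in> graphs_with_degrees V g" "two_switch E F"
  shows "F \<in> graphs_with_degrees V g"
proof -
  have E: "simple_graph V E" "\<forall>v\<in>V. degree E v = g v"
    using assms(1) by (auto simp: graphs_with_degrees_def)
  then show ?thesis
    using two_switch_simple_graph[OF E(1) assms(2)] two_switch_degree[OF finite_edges[OF E(1)] assms(2)]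
    by (simp add: graphs_with_degrees_def)
qed

section \<open>Hypercube realization graphs\<close>

definition differing :: "nat \<Rightarrow> bool list \<Rightarrow> bool list \<Rightarrow> nat set" where
  "differing m xs ys = {i. i < m \<and> xs ! i \<noteq> ys ! i}"

lemma differing_eq_imp_eq:
  assumes "differing m xs ys = differing m xs zs" "length ys = m" "length zs = m"
  shows "ys = zs"
  using assms by (intro nth_equalityI) (auto simp: differing_def set_eq_iff)

lemma differing_sym_diff:
  "differing m ys zs = sym_diff (differing m xs ys) (differing m xs zs)"
  by (auto simp: differing_def)

text \<open>Closure under switches supplies membership in \<open>R\<close> for every graph
  constructed from a forbidden pattern.\<close>

locale switch_hypercube =
  fixes R :: "'a set set set"
  assumes cube: "hypercube R (switch_edges R)"
    and closed: "\<And>E F. E \<in> R \<Longrightarrow> two_switch E F \<Longrightarrow> F \<in> R"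
begin

text \<open>Two neighbours of a vertex are reached by changing coordinates \<open>i\<close> and
  \<open>j\<close>; they differ in none or in two coordinates, never in one.\<close>

lemma no_triangle:
  assumes "E \<in> R" "two_switch E F" "two_switch E G" "two_switch F G"
  shows False
proof -
  obtain m f where f: "bij_betw f R {xs :: bool list. length xs = m}"
    "\<forall>x\<in>R. \<forall>y\<in>R. {x, y} \<in> switch_edges R \<longleftrightarrow> card (differing m (f x) (f y)) = 1"
    using cube unfolding hypercube_def differing_def by blast
  have R: "F \<in> R" "G \<in> R" using assms closed by auto
  obtain i j where "differing m (f E) (f F) = {i}" "differing m (f E) (f G) = {j}"
    using f(2) R assms switch_edges_iff by (metis card_1_singletonE)
  then have "differing m (f F) (f G) = sym_diff {i} {j}"
    using differing_sym_diff by metis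
  then have "card (differing m (f F) (f G)) \<noteq> 1" by (cases "i = j") auto
  then show False using f(2) R assms switch_edges_iff by metis
qed

text \<open>Distinct vertices with a common neighbour differ in two coordinates, and a common
  neighbour amounts to the choice which of the two to change first. Three distinct ones are too
  many.\<close>

lemma no_K23:
  assumes "E \<in> R" "E \<noteq> G" "distinct [F1, F2, F3]"
    and EF: "\<forall>F\<in>{F1, F2, F3}. two_switch E F \<and> two_switch F G"
  shows False
proof -
  obtain m f where f: "bij_betw f R {xs :: bool list. length xs = m}"
    "\<forall>x\<in>R. \<forall>y\<in>R. {x, y} \<in> switch_edges R \<longleftrightarrow> card (differing m (f x) (f y)) = 1"
    using cube unfolding hypercube_def differing_def by blast
  have R: "F1 \<in> R" "F2 \<in> R" "F3 \<in> R" "G \<in> R" using assms closed by auto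
  have len: "length (f H) = m" if "H \<in> R" for H using f(1) that by (auto simp: bij_betw_def)
  have inj: "H = H'" if "H \<in> R" "H' \<in> R" "f H = f H'" for H H'
    using f(1) that by (meson bij_betw_def inj_onD)
  have "\<exists>i j. differing m (f E) (f F) = {i} \<and> differing m (f E) (f G) = {i, j} \<and> i \<noteq> j"
    if "F \<in> {F1, F2, F3}" for F
  proof -
    have FR: "F \<in> R" using that R by auto
    have c: "card (differing m (f E) (f F)) = 1" "card (differing m (f F) (f G)) = 1"
      using f(2) FR R EF that \<open>E \<in> R\<close> switch_edges_iff by metis+
    then obtain i j where ij: "differing m (f E) (f F) = {i}" "differing m (f F) (f G) = {j}"
      by (metis card_1_singletonE)
    have "differing m (f E) (f F) = differing m (f F) (f E)" by (auto simp: differing_def)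
    then have e: "differing m (f E) (f G) = sym_diff {i} {j}"
      using differing_sym_diff ij by metis
    have "i \<noteq> j"
    proof
      assume "i = j"
      then have "differing m (f E) (f G) = differing m (f E) (f E)" using e by (auto simp: differing_def)
      then have "f G = f E" using differing_eq_imp_eq len R \<open>E \<in> R\<close> by metis
      then show False using inj R \<open>E \<in> R\<close> \<open>E \<noteq> G\<close> by metis
    qed
    then show ?thesis using ij e by blast
  qed
  then obtain i1 j1 i2 j2 i3 j3 where
      i: "differing m (f E) (f F1) = {i1}" "differing m (f E) (f F2) = {i2}" "differing m (f E) (f F3) = {i3}"
    and "differing m (f E) (f G) = {i1, j1}" "differing m (f E) (f G) = {i2, j2}"
        "differing m (f E) (f G) = {i3, j3}" 
    by (metis insertCI)
  then have "i1 = i2 \<or> i1 = i3 \<or> i2 = i3" by (metis doubleton_eq_iff)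
  then have "f F1 = f F2 \<or> f F1 = f F3 \<or> f F2 = f F3"
    using i differing_eq_imp_eq len R by metis
  then show False using inj R assms(3) by auto
qed

text \<open>The three perfect matchings on \<open>a, b, c, d\<close> are pairwise exchanged by a
  switch; \<open>E\<close> induces one of them, and the other two complete a triangle.\<close>

lemma no_2K2:
  assumes "E \<in> R" "distinct [a, b, c, d]" "{a, b} \<in> E" "{c, d} \<in> E"
    "{a, c} \<notin> E" "{a, d} \<notin> E" "{b, c} \<notin> E" "{b, d} \<notin> E"
  shows False
proof -
  \<comment> \<open>The reversed list supplies every inequality to the simplifier in the opposite
    orientation.\<close>
  have rev: "distinct [d, c, b, a]" using assms(2) by auto
  let ?S1 = "{{a, b}, {c, d}, {a, d}, {b, c}}"
  let ?T = "{{a, b}, {c, d}, {a, c}, {b, d}}"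
  have "two_switch E (flip E ?S1)"
    by (rule two_switch_flip0I[of a b c d]) (use assms rev in \<open>simp_all add: doubleton_eq_iff\<close>)
  moreover have "two_switch E (flip E ?T)"
    by (rule two_switch_flip0I[of a b d c]) (use assms rev in \<open>simp_all add: doubleton_eq_iff\<close>)
  moreover have "two_switch (flip E ?S1) (flip E ?T)"
    by (rule two_switch_flipI[OF _ _ _ _ _ _ _ _ _ flip_eqI, of a d b c "{a, d}" "{b, c}" "{a, c}" "{b, d}"])
      (use assms rev in \<open>simp_all add: doubleton_eq_iff\<close>)
  ultimately show False using no_triangle[OF assms(1)] by blast
qed

text \<open>The complementary situation: each of the three graphs misses exactly one perfect
  matching on \<open>a, b, c, d\<close>.\<close>

lemma no_C4:
  assumes "E \<in> R" "distinct [a, b, c, d]" "{a, b} \<in> E" "{b, c} \<in> E" "{c, d} \<in> E" "{d, a} \<in> E"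
    "{a, c} \<notin> E" "{b, d} \<notin> E"
  shows False
proof -
  have rev: "distinct [d, c, b, a]" using assms(2) by auto
  let ?S1 = "{{a, b}, {c, d}, {a, c}, {b, d}}"
  let ?T = "{{d, a}, {b, c}, {a, c}, {b, d}}"
  have "two_switch E (flip E ?S1)"
    by (rule two_switch_flip0I[of a b d c]) (use assms rev in \<open>simp_all add: doubleton_eq_iff\<close>)
  moreover have "two_switch E (flip E ?T)"
    by (rule two_switch_flip0I[of a d b c]) (use assms rev in \<open>simp_all add: doubleton_eq_iff\<close>)
  moreover have "two_switch (flip E ?S1) (flip E ?T)"
    by (rule two_switch_flipI[OF _ _ _ _ _ _ _ _ _ flip_eqI, of a d c b "{d, a}" "{b, c}" "{a, b}" "{c, d}"])
      (use assms rev in \<open>simp_all add: doubleton_eq_iff\<close>)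
  ultimately show False using no_triangle[OF assms(1)] by blast
qed

text \<open>Among \<open>u, v, w\<close>, vertex \<open>q\<close> has one neighbour and
  \<open>p\<close> has the other two. Any of the three can be the neighbour of \<open>q\<close>, and
  each of these choices is one switch away from the others.\<close>

lemma no_double_difference:
  assumes "E \<in> R" "distinct [p, q, u, v, w]" "{p, u} \<in> E" "{p, v} \<in> E" "{q, w} \<in> E"
    "{p, w} \<notin> E" "{q, u} \<notin> E" "{q, v} \<notin> E"
  shows False
proof -
  have rev: "distinct [w, v, u, q, p]" using assms(2) by auto
  let ?S1 = "{{p, u}, {q, w}, {p, w}, {q, u}}"
  let ?T = "{{p, v}, {q, w}, {p, w}, {q, v}}"
  have "two_switch E (flip E ?S1)"
    by (rule two_switch_flip0I[of p u q w]) (use assms rev in \<open>simp_all add: doubleton_eq_iff\<close>)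
  moreover have "two_switch E (flip E ?T)"
    by (rule two_switch_flip0I[of p v q w]) (use assms rev in \<open>simp_all add: doubleton_eq_iff\<close>)
  moreover have "two_switch (flip E ?S1) (flip E ?T)"
    by (rule two_switch_flipI[OF _ _ _ _ _ _ _ _ _ flip_eqI, of p v q u "{p, v}" "{q, u}" "{p, u}" "{q, v}"])
      (use assms rev in \<open>simp_all add: doubleton_eq_iff\<close>)
  ultimately show False using no_triangle[OF assms(1)] by blast
qed

text \<open>
  The switches among the realizations of a \<open>3 \<times> 3\<close> permutation pattern are the transpositions; the
  identity and a 3-cycle have all three transpositions as common neighbours.
\<close>

lemma no_I3:
  assumes "E \<in> R" "distinct [x, y, z, a, b, c]" "{x, a} \<in> E" "{y, b} \<in> E" "{z, c} \<in> E"
    "{x, b} \<notin> E" "{x, c} \<notin> E" "{y, a} \<notin> E" "{y, c} \<notin> E" "{z, a} \<notin> E" "{z, b} \<notin> E"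
  shows False
proof -
  have rev: "distinct [c, b, a, z, y, x]" using assms(2) by auto
  let ?S1 = "{{x, a}, {y, b}, {x, b}, {y, a}}"
  let ?S2 = "{{y, b}, {z, c}, {y, c}, {z, b}}"
  let ?S3 = "{{x, a}, {z, c}, {x, c}, {z, a}}"
  let ?T = "{{x, a}, {x, b}, {y, b}, {y, c}, {z, a}, {z, c}}"
  have "two_switch E (flip E ?S1)"
    by (rule two_switch_flip0I[of x a y b]) (use assms rev in \<open>simp_all add: doubleton_eq_iff\<close>)
  moreover have "two_switch (flip E ?S1) (flip E ?T)"
    by (rule two_switch_flipI[OF _ _ _ _ _ _ _ _ _ flip_eqI, of y a z c "{y, a}" "{z, c}" "{y, c}" "{z, a}"])
      (use assms rev in \<open>simp_all add: doubleton_eq_iff\<close>)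
  moreover have "two_switch E (flip E ?S2)"
    by (rule two_switch_flip0I[of y b z c]) (use assms rev in \<open>simp_all add: doubleton_eq_iff\<close>)
  moreover have "two_switch (flip E ?S2) (flip E ?T)"
    by (rule two_switch_flipI[OF _ _ _ _ _ _ _ _ _ flip_eqI, of x a z b "{x, a}" "{z, b}" "{x, b}" "{z, a}"])
      (use assms rev in \<open>simp_all add: doubleton_eq_iff\<close>)
  moreover have "two_switch E (flip E ?S3)"
    by (rule two_switch_flip0I[of x a z c]) (use assms rev in \<open>simp_all add: doubleton_eq_iff\<close>)
  moreover have "two_switch (flip E ?S3) (flip E ?T)"
    by (rule two_switch_flipI[OF _ _ _ _ _ _ _ _ _ flip_eqI, of x c y b "{x, c}" "{y, b}" "{x, b}" "{y, c}"])
      (use assms rev in \<open>simp_all add: doubleton_eq_iff\<close>)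
  moreover have "?S1 \<noteq> ?S2" "?S2 \<noteq> ?S3" "?S3 \<noteq> ?S1"
    using assms(2) rev by (simp_all add: set_eq_subset doubleton_eq_iff)
  then have "distinct [flip E ?S1, flip E ?S2, flip E ?S3]" by auto
  moreover have "E \<noteq> flip E ?T" using flip_cancel[of E "{}" ?T] by simp
  ultimately show False using no_K23[OF assms(1), of "flip E ?T" "flip E ?S1" "flip E ?S2" "flip E ?S3"] by simp
qed

text \<open>The permutation argument applied to the non-edges: they form a matching between the two
  triples, and switches permute it by transpositions.\<close>

lemma no_J3:
  assumes "E \<in> R" "distinct [x, y, z, a, b, c]" "{x, a} \<notin> E" "{y, b} \<notin> E" "{z, c} \<notin> E"
    "{x, b} \<in> E" "{x, c} \<in> E" "{y, a} \<in> E" "{y, c} \<in> E" "{z, a} \<in> E" "{z, b} \<in> E"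
  shows False
proof -
  have rev: "distinct [c, b, a, z, y, x]" using assms(2) by auto
  let ?S1 = "{{x, b}, {y, a}, {x, a}, {y, b}}"
  let ?S2 = "{{y, c}, {z, b}, {y, b}, {z, c}}"
  let ?S3 = "{{x, c}, {z, a}, {x, a}, {z, c}}"
  let ?T = "{{x, a}, {x, b}, {y, b}, {y, c}, {z, a}, {z, c}}"
  have "two_switch E (flip E ?S1)"
    by (rule two_switch_flip0I[of x b y a]) (use assms rev in \<open>simp_all add: doubleton_eq_iff\<close>)
  moreover have "two_switch (flip E ?S1) (flip E ?T)"
    by (rule two_switch_flipI[OF _ _ _ _ _ _ _ _ _ flip_eqI, of y c z a "{y, c}" "{z, a}" "{y, a}" "{z, c}"])
      (use assms rev in \<open>simp_all add: doubleton_eq_iff\<close>)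
  moreover have "two_switch E (flip E ?S2)"
    by (rule two_switch_flip0I[of y c z b]) (use assms rev in \<open>simp_all add: doubleton_eq_iff\<close>)
  moreover have "two_switch (flip E ?S2) (flip E ?T)"
    by (rule two_switch_flipI[OF _ _ _ _ _ _ _ _ _ flip_eqI, of x b z a "{x, b}" "{z, a}" "{x, a}" "{z, b}"])
      (use assms rev in \<open>simp_all add: doubleton_eq_iff\<close>)
  moreover have "two_switch E (flip E ?S3)"
    by (rule two_switch_flip0I[of x c z a]) (use assms rev in \<open>simp_all add: doubleton_eq_iff\<close>)
  moreover have "two_switch (flip E ?S3) (flip E ?T)"
    by (rule two_switch_flipI[OF _ _ _ _ _ _ _ _ _ flip_eqI, of x b y c "{x, b}" "{y, c}" "{x, c}" "{y, b}"])
      (use assms rev in \<open>simp_all add: doubleton_eq_iff\<close>)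
  moreover have "?S1 \<noteq> ?S2" "?S2 \<noteq> ?S3" "?S3 \<noteq> ?S1"
    using assms(2) rev by (simp_all add: set_eq_subset doubleton_eq_iff)
  then have "distinct [flip E ?S1, flip E ?S2, flip E ?S3]" by auto
  moreover have "E \<noteq> flip E ?T" using flip_cancel[of E "{}" ?T] by simp
  ultimately show False using no_K23[OF assms(1), of "flip E ?T" "flip E ?S1" "flip E ?S2" "flip E ?S3"] by simp
qed

text \<open>All graphs involved induce 5-cycles. \<open>E\<close> gives the cycle
  \<open>a b c d e\<close>, the target is \<open>a c d b e\<close>, and the three intermediate ones
  are \<open>a c b d e\<close>, \<open>a b d c e\<close> and \<open>a c d e b\<close>.\<close>

lemma no_C5:
  assumes "E \<in> R" "distinct [a, b, c, d, e]"
    "{a, b} \<in> E" "{b, c} \<in> E" "{c, d} \<in> E" "{d, e} \<in> E" "{e, a} \<in> E"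
    "{a, c} \<notin> E" "{b, d} \<notin> E" "{c, e} \<notin> E" "{d, a} \<notin> E" "{e, b} \<notin> E"
  shows False
proof -
  have rev: "distinct [e, d, c, b, a]" using assms(2) by auto
  let ?S1 = "{{a, b}, {c, d}, {a, c}, {b, d}}"
  let ?S2 = "{{b, c}, {d, e}, {b, d}, {c, e}}"
  let ?S3 = "{{e, a}, {b, c}, {a, c}, {e, b}}"
  let ?T = "{{a, b}, {b, c}, {d, e}, {a, c}, {b, d}, {e, b}}"
  have "two_switch E (flip E ?S1)"
    by (rule two_switch_flip0I[of a b d c]) (use assms rev in \<open>simp_all add: doubleton_eq_iff\<close>)
  moreover have "two_switch (flip E ?S1) (flip E ?T)"
    by (rule two_switch_flipI[OF _ _ _ _ _ _ _ _ _ flip_eqI, of b c d e "{b, c}" "{d, e}" "{e, b}" "{c, d}"])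
      (use assms rev in \<open>simp_all add: doubleton_eq_iff\<close>)
  moreover have "two_switch E (flip E ?S2)"
    by (rule two_switch_flip0I[of b c e d]) (use assms rev in \<open>simp_all add: doubleton_eq_iff\<close>)
  moreover have "two_switch (flip E ?S2) (flip E ?T)"
    by (rule two_switch_flipI[OF _ _ _ _ _ _ _ _ _ flip_eqI, of a b e c "{a, b}" "{c, e}" "{a, c}" "{e, b}"])
      (use assms rev in \<open>simp_all add: doubleton_eq_iff\<close>)
  moreover have "two_switch E (flip E ?S3)"
    by (rule two_switch_flip0I[of a e b c]) (use assms rev in \<open>simp_all add: doubleton_eq_iff\<close>)
  moreover have "two_switch (flip E ?S3) (flip E ?T)"
    by (rule two_switch_flipI[OF _ _ _ _ _ _ _ _ _ flip_eqI, of a b d e "{a, b}" "{d, e}" "{e, a}" "{b, d}"])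
      (use assms rev in \<open>simp_all add: doubleton_eq_iff\<close>)
  moreover have "?S1 \<noteq> ?S2" "?S2 \<noteq> ?S3" "?S3 \<noteq> ?S1"
    using assms(2) rev by (simp_all add: set_eq_subset doubleton_eq_iff)
  then have "distinct [flip E ?S1, flip E ?S2, flip E ?S3]" by auto
  moreover have "E \<noteq> flip E ?T" using flip_cancel[of E "{}" ?T] by simp
  ultimately show False using no_K23[OF assms(1), of "flip E ?T" "flip E ?S1" "flip E ?S2" "flip E ?S3"] by simp
qed

end

section \<open>Split graphs\<close>

lemma finite_has_max_weight:
  fixes f :: "'b \<Rightarrow> nat"
  assumes "finite C" "C \<noteq> {}"
  obtains x where "x \<in> C" "\<And>y. y \<in> C \<Longrightarrow> f y \<le> f x"
proof -
  have "Max (f ` C) \<in> f ` C" using assms by (intro Max_in) auto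
  then obtain x where x: "Max (f ` C) = f x" "x \<in> C" by (rule imageE)
  have "f y \<le> f x" if "y \<in> C" for y
    unfolding x(1)[symmetric] using that assms(1) by (intro Max_ge finite_imageI imageI)
  with x(2) show ?thesis by (rule that)
qed

text \<open>
  Foldes and Hammer. The proof takes a clique of maximum total weight, where \<open>v\<close> weighs \<open>deg v + 1\<close>:
  it is inclusion-maximal, and an outside vertex that could replace a clique vertex has no larger
  degree.
\<close>

lemma split_graph_if_2K2_C4_C5_free:
  assumes graph: "simple_graph V E"
    and no_2K2: "\<And>a b c d. \<lbrakk>distinct [a, b, c, d]; {a, b} \<in> E; {c, d} \<in> E;
      {a, c} \<notin> E; {a, d} \<notin> E; {b, c} \<notin> E; {b, d} \<notin> E\<rbrakk> \<Longrightarrow> False"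
    and no_C4: "\<And>a b c d. \<lbrakk>distinct [a, b, c, d]; {a, b} \<in> E; {b, c} \<in> E; {c, d} \<in> E; {d, a} \<in> E;
      {a, c} \<notin> E; {b, d} \<notin> E\<rbrakk> \<Longrightarrow> False"
    and no_C5: "\<And>a b c d e. \<lbrakk>distinct [a, b, c, d, e];
      {a, b} \<in> E; {b, c} \<in> E; {c, d} \<in> E; {d, e} \<in> E; {e, a} \<in> E;
      {a, c} \<notin> E; {b, d} \<notin> E; {c, e} \<notin> E; {d, a} \<notin> E; {e, b} \<notin> E\<rbrakk> \<Longrightarrow> False"
  shows "split_graph V E"
proof -
  have "finite V" using graph by (simp add: simple_graph_def)
  define adj where "adj u v \<longleftrightarrow> {u, v} \<in> E" for u v
  have sym: "adj u v \<longleftrightarrow> adj v u" for u v by (simp add: adj_def insert_commute)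
  have irrefl: "\<not> adj v v" for v using simple_graph_edgeD(3)[OF graph, of v v] unfolding adj_def by auto
  have inV: "adj u v \<Longrightarrow> u \<in> V \<and> v \<in> V" for u v
    using simple_graph_edgeD[OF graph, of u v] unfolding adj_def by simp
  \<comment> \<open>\<open>Suc\<close> makes isolated vertices count as well, so enlarging a clique
    always increases \<open>W\<close>.\<close>
  define W where "W K = (\<Sum>v\<in>K. Suc (degree E v))" for K
  define C where "C = {K. K \<subseteq> V \<and> clique K E}"
  have "finite C" using \<open>finite V\<close> unfolding C_def by simp
  moreover have "{} \<in> C" by (simp add: C_def clique_def)
  ultimately obtain K where "K \<in> C" and max: "\<And>K'. K' \<in> C \<Longrightarrow> W K' \<le> W K"
    using finite_has_max_weight[of C W] by blast
  then have K: "K \<subseteq> V" "clique K E" by (simp_all add: C_def)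
  have W_le: "W K' \<le> W K" if "K' \<subseteq> V" "clique K' E" for K'
    using max[of K'] that by (simp add: C_def)
  have "finite K" using K(1) \<open>finite V\<close> by (rule finite_subset)
  have K_adj: "adj u v" if "u \<in> K" "v \<in> K" "u \<noteq> v" for u v
    using K(2) that by (simp add: clique_def adj_def)
  have cliqueI: "clique K' E" if "\<And>u v. u \<in> K' \<Longrightarrow> v \<in> K' \<Longrightarrow> u \<noteq> v \<Longrightarrow> adj u v" for K'
    using that by (simp add: clique_def adj_def)
  have maximal: "\<exists>u\<in>K. \<not> adj x u" if "x \<in> V - K" for x
  proof (rule ccontr)
    assume "\<not> (\<exists>u\<in>K. \<not> adj x u)"
    then have "clique (insert x K) E" using K_adj sym by (intro cliqueI) blast
    then have "W (insert x K) \<le> W K" using that K(1) by (intro W_le) auto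
    then show False using that \<open>finite K\<close> by (simp add: W_def)
  qed
  have deg_le: "degree E x \<le> degree E u"
    if "x \<in> V - K" "u \<in> K" "\<forall>w\<in>K - {u}. adj x w" for x u
  proof -
    have "clique (insert x (K - {u})) E" using that K_adj sym by (intro cliqueI) blast
    then have "W (insert x (K - {u})) \<le> W K" using that K(1) by (intro W_le) auto
    moreover have "W (insert x (K - {u})) = Suc (degree E x) + W (K - {u})"
      using that \<open>finite K\<close> by (simp add: W_def)
    moreover have "W K = Suc (degree E u) + W (K - {u})"
      using that \<open>finite K\<close> unfolding W_def by (simp only: sum.remove)
    ultimately show ?thesis by simp
  qed
  \<comment> \<open>Here \<open>x\<close> could replace \<open>u\<close>, so \<open>deg_le\<close>
    applies; since \<open>y\<close> is adjacent to \<open>x\<close> but not to \<open>u\<close>,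
    some \<open>z\<close> is adjacent to \<open>u\<close> but not to \<open>x\<close>. Then
    \<open>y\<close> and \<open>z\<close> are adjacent by 2K2-freeness, and a vertex
    \<open>w\<close> of \<open>K\<close> missed by \<open>z\<close> closes a C4 or a C5.\<close>
  have no_swap: False
    if xy: "x \<in> V - K" "y \<in> V - K" "adj x y" and u: "u \<in> K" "\<not> adj x u" "\<not> adj y u"
      and others: "\<forall>w\<in>K - {u}. adj x w" for x y u
  proof -
    have "\<not> nbrs E u \<subset> nbrs E x"
    proof
      assume "nbrs E u \<subset> nbrs E x"
      then have "card (nbrs E u) < card (nbrs E x)"
        using finite_nbrs[OF graph] by (intro psubset_card_mono)
      then show False using deg_le[OF xy(1) u(1) others] by (simp add: degree_eq_card_nbrs[OF graph])
    qed
    moreover have "y \<in> nbrs E x" "y \<notin> nbrs E u" using xy(3) u(3) sym by (simp_all flip: adj_def)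
    ultimately obtain z where "z \<in> nbrs E u" "z \<notin> nbrs E x" by blast
    then have z: "adj u z" "\<not> adj x z" by (simp_all flip: adj_def)
    have "z \<noteq> x" "z \<noteq> y" "z \<noteq> u" using z u xy sym irrefl by blast+
    have "z \<in> V - K" using z others inV \<open>z \<noteq> u\<close> by blast
    have "x \<noteq> y" "u \<noteq> x" "u \<noteq> y" using xy u irrefl by blast+
    have "adj y z"
    proof (rule ccontr)
      assume "\<not> adj y z"
      then show False
        using no_2K2[of u z x y] z u xy \<open>x \<noteq> y\<close> \<open>u \<noteq> x\<close> \<open>u \<noteq> y\<close> \<open>z \<noteq> x\<close> \<open>z \<noteq> y\<close> \<open>z \<noteq> u\<close> sym
        unfolding adj_def[symmetric] by auto
    qed
    obtain w where w: "w \<in> K" "\<not> adj z w" using maximal[OF \<open>z \<in> V - K\<close>] by blast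
    have "w \<noteq> u" using w z sym by blast
    then have "adj x w" "adj u w" using w others K_adj u by auto
    have ne: "w \<noteq> x" "w \<noteq> y" "w \<noteq> z" using w xy \<open>z \<in> V - K\<close> by auto
    show False
    proof (cases "adj y w")
      case True
      then show False
        using no_C4[of u w y z] z u w \<open>adj u w\<close> \<open>adj y z\<close> ne \<open>w \<noteq> u\<close> \<open>u \<noteq> y\<close> \<open>z \<noteq> y\<close> \<open>z \<noteq> u\<close> sym
        unfolding adj_def[symmetric] by auto
    next
      case False
      then show False
        using no_C5[of u w x y z] z u w xy \<open>adj u w\<close> \<open>adj x w\<close> \<open>adj y z\<close> ne \<open>w \<noteq> u\<close>
          \<open>x \<noteq> y\<close> \<open>u \<noteq> x\<close> \<open>u \<noteq> y\<close> \<open>z \<noteq> x\<close> \<open>z \<noteq> y\<close> \<open>z \<noteq> u\<close> sym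
        unfolding adj_def[symmetric] by auto
    qed
  qed
  have "\<not> adj x y" if xy: "x \<in> V - K" "y \<in> V - K" for x y
  proof
    assume adj: "adj x y"
    then have "x \<noteq> y" using irrefl by blast
    \<comment> \<open>C4-freeness nests the non-neighbourhoods of \<open>x\<close> and
      \<open>y\<close> in \<open>K\<close>; both are nonempty by \<open>maximal\<close>, so they
      share a vertex \<open>u\<close>.\<close>
    have C4: False if "p \<in> K" "q \<in> K" "\<not> adj x p" "adj y p" "adj x q" "\<not> adj y q" for p q
    proof -
      have "p \<noteq> q" using that by blast
      then have "distinct [x, y, p, q]" "adj p q" using that xy \<open>x \<noteq> y\<close> K_adj by auto
      then show False
        using no_C4[of x y p q] that adj sym unfolding adj_def[symmetric] by auto
    qed
    obtain p q where pq: "p \<in> K" "\<not> adj x p" "q \<in> K" "\<not> adj y q" using maximal xy by meson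
    then obtain u where u: "u \<in> K" "\<not> adj x u" "\<not> adj y u" using C4[of p q] by blast
    have "p = u" if p: "p \<in> K" "\<not> adj x p" "\<not> adj y p" for p
    proof (rule ccontr)
      assume "p \<noteq> u"
      then have "distinct [x, y, p, u]" "adj p u" using p u xy \<open>x \<noteq> y\<close> K_adj by auto
      then show False
        using no_2K2[of x y p u] p u adj unfolding adj_def[symmetric] by auto
    qed
    \<comment> \<open>As \<open>u\<close> is the only shared vertex, the smaller of the nested
      non-neighbourhoods is just \<open>u\<close>.\<close>
    then have "(\<forall>w\<in>K - {u}. adj x w) \<or> (\<forall>w\<in>K - {u}. adj y w)" using C4 by blast
    then show False using no_swap[of x y u] no_swap[of y x u] xy adj u sym by blast
  qed
  then have "indep (V - K) E" by (simp add: indep_def adj_def)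
  then show ?thesis
    unfolding split_graph_def using K by (meson Diff_disjoint Diff_partition)
qed

text \<open>In a split partition the edge \<open>ab\<close> and the non-edge \<open>xy\<close> are
  automatic, so this records at once the induced path \<open>x a b y\<close> and the switch
  exchanging the edges \<open>xa, yb\<close> for \<open>xb, ya\<close>.\<close>

definition alternating :: "'a set \<Rightarrow> 'a set \<Rightarrow> 'a set set \<Rightarrow> 'a \<Rightarrow> 'a \<Rightarrow> 'a \<Rightarrow> 'a \<Rightarrow> bool" where
  "alternating K I E x y a b \<longleftrightarrow> x \<in> I \<and> y \<in> I \<and> a \<in> K \<and> b \<in> K \<and>
     {x, a} \<in> E \<and> {y, b} \<in> E \<and> {x, b} \<notin> E \<and> {y, a} \<notin> E"

lemma alternating_sym: "alternating K I E x y a b \<Longrightarrow> alternating K I E y x b a"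
  by (simp add: alternating_def)

text \<open>\<open>K\<close> and \<open>I\<close> are parameters rather than existential witnesses
  because the same partition will serve all realizations.\<close>

locale split_partition =
  fixes V K I :: "'a set" and E :: "'a set set"
  assumes graph: "simple_graph V E"
    and Un: "K \<union> I = V" and disj: "K \<inter> I = {}"
    and clique: "clique K E" and indep: "indep I E"
begin

lemma clique_edge: "u \<in> K \<Longrightarrow> v \<in> K \<Longrightarrow> u \<noteq> v \<Longrightarrow> {u, v} \<in> E"
  using clique by (simp add: clique_def)

lemma indep_edge: "u \<in> I \<Longrightarrow> v \<in> I \<Longrightarrow> {u, v} \<notin> E"
  using indep simple_graph_edgeD(3)[OF graph, of u v] unfolding indep_def by blast

lemma alternating_distinct:
  assumes "alternating K I E x y a b"
  shows "distinct [x, y, a, b]"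
proof -
  have "x \<noteq> y" "a \<noteq> b" using assms by (auto simp: alternating_def)
  then show ?thesis using assms disj by (auto simp: alternating_def)
qed

text \<open>The endpoints must lie in \<open>I\<close>: an endpoint in \<open>K\<close> would push
  both of its non-neighbours on the path, which are adjacent, into \<open>I\<close>. The middle
  vertices are then in \<open>K\<close>.\<close>

lemma induced_P4_iff:
  "induced_P4 V E S \<longleftrightarrow> (\<exists>x y a b. alternating K I E x y a b \<and> S = {x, y, a, b})"
proof
  assume "induced_P4 V E S"
  then obtain p q r s where *: "distinct [p, q, r, s]" "S = {p, q, r, s}" "S \<subseteq> V"
     "{p, q} \<in> E" "{q, r} \<in> E" "{r, s} \<in> E" "{p, r} \<notin> E" "{p, s} \<notin> E" "{q, s} \<notin> E"
    unfolding induced_P4_def by blast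
  have KI: "v \<in> K \<or> v \<in> I" if "v \<in> {p, q, r, s}" for v using *(2,3) Un that by blast
  have "p \<notin> K"
  proof
    assume "p \<in> K"
    then have "r \<notin> K" "s \<notin> K" using clique_edge[of p] *(1,7,8) by auto
    then show False using KI indep_edge[of r s] *(6) by blast
  qed
  moreover have "s \<notin> K"
  proof
    assume "s \<in> K"
    then have "p \<notin> K" "q \<notin> K" using clique_edge[of _ s] *(1,8,9) by auto
    then show False using KI indep_edge[of p q] *(4) by blast
  qed
  ultimately have "p \<in> I" "s \<in> I" using KI by blast+
  then have "q \<in> K" "r \<in> K" using KI indep_edge[of p q] indep_edge[of r s] *(4,6) by blast+
  have rev: "{s, r} = {r, s}" "{s, q} = {q, s}" by auto
  have "alternating K I E p s q r"
    unfolding alternating_def rev using \<open>p \<in> I\<close> \<open>s \<in> I\<close> \<open>q \<in> K\<close> \<open>r \<in> K\<close> * by simp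
  moreover have "S = {p, s, q, r}" using *(2) by auto
  ultimately show "\<exists>x y a b. alternating K I E x y a b \<and> S = {x, y, a, b}" by blast
next
  assume "\<exists>x y a b. alternating K I E x y a b \<and> S = {x, y, a, b}"
  then obtain x y a b where *: "alternating K I E x y a b" "S = {x, y, a, b}" by blast
  have d: "distinct [x, y, a, b]" using *(1) by (rule alternating_distinct)
  have rev: "{b, y} = {y, b}" "{a, y} = {y, a}" by auto
  show "induced_P4 V E S"
    unfolding induced_P4_def
  proof (rule exI[of _ x], rule exI[of _ a], rule exI[of _ b], rule exI[of _ y], intro conjI)
    show "{a, b} \<in> E" using * d by (intro clique_edge) (auto simp: alternating_def)
    show "{x, y} \<notin> E" using * by (intro indep_edge) (auto simp: alternating_def)
    show "S \<subseteq> V" using * Un by (auto simp: alternating_def)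
    show "S = {x, a, b, y}" using * by auto
    show "distinct [x, a, b, y]" using d by auto
  qed (use *(1) in \<open>simp_all add: alternating_def rev\<close>)
qed

text \<open>Going round the four vertices, an edge cannot have both ends in \<open>I\<close> and a
  non-edge cannot have both in \<open>K\<close>, so the two sides alternate.\<close>

lemma two_switch_iff:
  "two_switch E F \<longleftrightarrow>
    (\<exists>x y a b. alternating K I E x y a b \<and> F = E - {{x, a}, {y, b}} \<union> {{x, b}, {y, a}})"
proof
  assume "two_switch E F"
  then obtain p q r s where *: "distinct [p, q, r, s]" "{p, q} \<in> E" "{r, s} \<in> E"
     "{p, s} \<notin> E" "{q, r} \<notin> E" "F = E - {{p, q}, {r, s}} \<union> {{p, s}, {q, r}}"
    unfolding two_switch_def by blast
  have KI: "v \<in> K \<or> v \<in> I" if "v \<in> {p, q, r, s}" for v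
    using simple_graph_edgeD[OF graph] *(2,3) Un that by blast
  have rev: "{q, p} = {p, q}" "{s, r} = {r, s}" "{s, p} = {p, s}" "{r, q} = {q, r}" by auto
  show "\<exists>x y a b. alternating K I E x y a b \<and> F = E - {{x, a}, {y, b}} \<union> {{x, b}, {y, a}}"
  proof (cases "p \<in> K")
    case True
    then have "s \<in> I" using KI clique_edge[of p s] *(1,4) by auto
    then have "r \<in> K" using KI indep_edge[of r s] *(3) by blast
    then have "q \<in> I" using KI clique_edge[of q r] *(1,5) by auto
    have "alternating K I E q s p r"
      unfolding alternating_def rev using True \<open>s \<in> I\<close> \<open>q \<in> I\<close> \<open>r \<in> K\<close> * by simp
    moreover have "F = E - {{q, p}, {s, r}} \<union> {{q, r}, {s, p}}"
      unfolding rev *(6) by (simp add: insert_commute)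
    ultimately show ?thesis by blast
  next
    case False
    then have "p \<in> I" using KI by blast
    then have "q \<in> K" using KI indep_edge[of p q] *(2) by blast
    then have "r \<in> I" using KI clique_edge[of q r] *(1,5) by auto
    then have "s \<in> K" using KI indep_edge[of r s] *(3) by blast
    have "alternating K I E p r q s"
      unfolding alternating_def rev using \<open>p \<in> I\<close> \<open>s \<in> K\<close> \<open>q \<in> K\<close> \<open>r \<in> I\<close> * by simp
    moreover have "F = E - {{p, q}, {r, s}} \<union> {{p, s}, {r, q}}"
      unfolding rev *(6) ..
    ultimately show ?thesis by blast
  qed
next
  assume "\<exists>x y a b. alternating K I E x y a b \<and> F = E - {{x, a}, {y, b}} \<union> {{x, b}, {y, a}}"
  then obtain x y a b where *: "alternating K I E x y a b" "F = E - {{x, a}, {y, b}} \<union> {{x, b}, {y, a}}"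
    by blast
  have rev: "{a, y} = {y, a}" by auto
  show "two_switch E F"
  proof (rule two_switchI[of x a y b])
    show "distinct [x, a, y, b]" using alternating_distinct[OF *(1)] by auto
  qed (use * in \<open>simp_all add: alternating_def rev\<close>)
qed

end

section \<open>Induced paths when the realization graph is a hypercube\<close>

context switch_hypercube
begin

text \<open>Only edges between the disjoint sets \<open>A\<close> and \<open>B\<close> are
  mentioned, so the lemma serves both for \<open>A = I, B = K\<close> and with the roles exchanged.
  Each way in which two alternating quadruples through \<open>x\<close> could differ contains a
  forbidden pattern.\<close>

lemma alternating_unique:
  assumes "E \<in> R" and disj: "A \<inter> B = {}"
    and A: "x \<in> A" "y \<in> A" "z \<in> A" and B: "a \<in> B" "b \<in> B" "a' \<in> B" "b' \<in> B"
    and E: "{x, a} \<in> E" "{y, b} \<in> E" "{x, b} \<notin> E" "{y, a} \<notin> E"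
    and E': "{x, a'} \<in> E" "{z, b'} \<in> E" "{x, b'} \<notin> E" "{z, a'} \<notin> E"
  shows "y = z \<and> a = a' \<and> b = b'"
proof -
  define r where "r p u \<longleftrightarrow> {p, u} \<in> E" for p u
  have flip: "{u, p} \<in> E \<longleftrightarrow> r p u" for p u by (simp add: r_def insert_commute)
  have AB: "p \<noteq> u" "u \<noteq> p" if "p \<in> A" "u \<in> B" for p u using disj that by blast+
  \<comment> \<open>\<open>rows\<close> and \<open>cols\<close> are the double-difference pattern
    seen from \<open>A\<close> and from \<open>B\<close>.\<close>
  have rows: False if "p \<in> A" "q \<in> A" "u \<in> B" "v \<in> B" "w \<in> B" "u \<noteq> v"
    "r p u" "r p v" "r q w" "\<not> r p w" "\<not> r q u" "\<not> r q v" for p q u v w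
  proof -
    have "distinct [p, q, u, v, w]" using that AB by auto
    then show False using no_double_difference[OF \<open>E \<in> R\<close>, of p q u v w] that by (simp add: r_def)
  qed
  have cols: False if "p \<in> A" "q \<in> A" "s \<in> A" "u \<in> B" "v \<in> B" "p \<noteq> q"
    "r p u" "r q u" "r s v" "\<not> r s u" "\<not> r p v" "\<not> r q v" for p q s u v
  proof -
    have "distinct [u, v, p, q, s]" using that AB by auto
    then show False using no_double_difference[OF \<open>E \<in> R\<close>, of u v p q s] that by (simp add: flip)
  qed
  have r: "r x a" "r y b" "\<not> r x b" "\<not> r y a" "r x a'" "r z b'" "\<not> r x b'" "\<not> r z a'"
    using E E' by (simp_all add: r_def)
  have ya': "r y a'" "r z a" if "a \<noteq> a'"
    using rows[of x y a a' b] rows[of x z a a' b'] that r A B by blast+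
  have yb': "\<not> r y b'" "\<not> r z b" if "b \<noteq> b'"
    using rows[of y x b b' a] rows[of z x b b' a'] that r A B by blast+
  have "y = z"
  proof (rule ccontr)
    assume "y \<noteq> z"
    have ne: "a \<noteq> b" "a \<noteq> b'" "a' \<noteq> b" "a' \<noteq> b'" "x \<noteq> y" "x \<noteq> z" using r by blast+
    \<comment> \<open>Distinct \<open>y\<close> and \<open>z\<close> give, in this order, a double
      difference of columns, the identity pattern, its complement, and a double difference of
      rows.\<close>
    consider "a = a'" "b = b'" | "a = a'" "b \<noteq> b'" | "a \<noteq> a'" "b = b'" | "a \<noteq> a'" "b \<noteq> b'" by blast
    then show False
    proof cases
      case 1
      then show False using cols[of y z x b a] r A B \<open>y \<noteq> z\<close> by blast
    next
      case 2
      have "distinct [x, y, z, a, b, b']" using 2 \<open>y \<noteq> z\<close> ne A B AB by auto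
      then show False
        using no_I3[OF \<open>E \<in> R\<close>, of x y z a b b'] r yb' 2 unfolding r_def[symmetric] by blast
    next
      case 3
      have "distinct [x, y, z, b, a, a']" using 3 \<open>y \<noteq> z\<close> ne A B AB by auto
      then show False
        using no_J3[OF \<open>E \<in> R\<close>, of x y z b a a'] r ya' 3 unfolding r_def[symmetric] by blast
    next
      case 4
      then show False using rows[of y z a' b b'] r ya' yb' A B ne by blast
    qed
  qed
  \<comment> \<open>With \<open>y = z\<close>, the facts \<open>ya'\<close> and \<open>yb'\<close>
    would contradict that \<open>z\<close> is adjacent to \<open>b'\<close> and not to
    \<open>a'\<close>.\<close>
  moreover from this have "a = a'" "b = b'" using ya' yb' r by blast+
  ultimately show ?thesis by blast
qed

lemma P4_reducible:
  assumes "E \<in> R" and split: "split_partition V K I E"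
  shows "P4_reducible V E"
proof -
  interpret split_partition V K I E by (fact split)
  have disj': "I \<inter> K = {}" using disj by blast
  have I: "{x, y, a, b} = {x, y', a', b'}"
    if *: "alternating K I E x y a b" "alternating K I E x y' a' b'" for x y a b y' a' b'
  proof -
    have "y = y' \<and> a = a' \<and> b = b'"
      by (rule alternating_unique[OF \<open>E \<in> R\<close> disj', of x y y' a b a' b'])
        (use * in \<open>simp_all add: alternating_def\<close>)
    then show ?thesis by simp
  qed
  have K: "{x, y, a, b} = {x', y', a, b'}"
    if *: "alternating K I E x y a b" "alternating K I E x' y' a b'" for x y a b x' y' b'
  proof -
    have rev: "{a, x} = {x, a}" "{a, y} = {y, a}" "{b, x} = {x, b}" "{b, y} = {y, b}"
      "{a, x'} = {x', a}" "{a, y'} = {y', a}" "{b', x'} = {x', b'}" "{b', y'} = {y', b'}" by auto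
    have "b = b' \<and> x = x' \<and> y = y'"
      by (rule alternating_unique[OF \<open>E \<in> R\<close> disj, of a b b' x y x' y'])
        (use * in \<open>simp_all add: alternating_def rev\<close>)
    then show ?thesis by simp
  qed
  \<comment> \<open>By the symmetry of \<open>alternating\<close>, a vertex of the path may be
    assumed to stand in first position on its side.\<close>
  have through: "\<exists>x y a b. alternating K I E x y a b \<and> S = {x, y, a, b} \<and> (v = x \<or> v = a)"
    if P4: "induced_P4 V E S" "v \<in> S" for v S
  proof -
    obtain x y a b where *: "alternating K I E x y a b" "S = {x, y, a, b}"
      using P4(1) unfolding induced_P4_iff by (elim exE conjE)
    show ?thesis
    proof (cases "v = x \<or> v = a")
      case True
      show ?thesis
        by (rule exI[of _ x], rule exI[of _ y], rule exI[of _ a], rule exI[of _ b]) (use * True in simp)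
    next
      case False
      then have "v = y \<or> v = b" using P4(2) unfolding *(2) by simp
      moreover have "S = {y, x, b, a}" unfolding *(2) by (simp add: insert_commute)
      ultimately show ?thesis
        by - (rule exI[of _ y], rule exI[of _ x], rule exI[of _ b], rule exI[of _ a],
          simp add: alternating_sym[OF *(1)])
    qed
  qed
  show ?thesis
    unfolding P4_reducible_def
  proof (intro ballI allI impI, elim conjE)
    fix v S T
    assume *: "induced_P4 V E S" "v \<in> S" "induced_P4 V E T" "v \<in> T"
    obtain x y a b where S: "alternating K I E x y a b" "S = {x, y, a, b}" "v = x \<or> v = a"
      using through[OF *(1,2)] by (elim exE conjE)
    obtain x' y' a' b' where T: "alternating K I E x' y' a' b'" "T = {x', y', a', b'}" "v = x' \<or> v = a'"
      using through[OF *(3,4)] by (elim exE conjE)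
    have "x \<in> I" "a \<in> K" "x' \<in> I" "a' \<in> K" using S(1) T(1) by (simp_all add: alternating_def)
    then have "x = x' \<or> a = a'" using S(3) T(3) disj by blast
    then show "S = T"
    proof
      assume "x = x'"
      then show ?thesis using I[OF S(1), of y' a' b'] T(1) unfolding S(2) T(2) by simp
    next
      assume "a = a'"
      then show ?thesis using K[OF S(1), of x' y' b'] T(1) unfolding S(2) T(2) by simp
    qed
  qed
qed

end

lemma hypercube_imp_split_P4_reducible:
  assumes cube: "hypercube (graphs_with_degrees V g) (switch_edges (graphs_with_degrees V g))"
    and E: "E \<in> graphs_with_degrees V g"
  shows "split_graph V E \<and> P4_reducible V E"
proof -
  interpret switch_hypercube "graphs_with_degrees V g"
    by unfold_locales (use cube two_switch_graphs_with_degrees in auto)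
  have graph: "simple_graph V E" using E by (simp add: graphs_with_degrees_def)
  have "split_graph V E"
    using graph no_2K2[OF E] no_C4[OF E] no_C5[OF E] by (rule split_graph_if_2K2_C4_C5_free)
  moreover from this obtain K I where "split_partition V K I E"
    using graph unfolding split_graph_def split_partition_def by blast
  then have "P4_reducible V E" using E by (intro P4_reducible)
  ultimately show ?thesis by blast
qed

section \<open>Realizations of a split graph\<close>

text \<open>Double counting of the edges between \<open>K\<close> and \<open>I\<close>.\<close>

lemma sum_card_nbrs_swap:
  assumes "finite K" "finite I"
  shows "(\<Sum>v\<in>K. card (nbrs E v \<inter> I)) = (\<Sum>v\<in>I. card (nbrs E v \<inter> K))"
proof -
  have card_eq: "card (nbrs E v \<inter> A) = (\<Sum>w\<in>A. if {v, w} \<in> E then 1 else 0)" if "finite A" for v A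
  proof -
    have "nbrs E v \<inter> A = {w \<in> A. {v, w} \<in> E}" by auto
    then show ?thesis using that by (simp add: sum.If_cases Int_def)
  qed
  have "(\<Sum>v\<in>K. card (nbrs E v \<inter> I)) = (\<Sum>v\<in>K. \<Sum>w\<in>I. if {v, w} \<in> E then 1 else 0)"
    by (simp only: card_eq[OF assms(2)])
  also have "\<dots> = (\<Sum>w\<in>I. \<Sum>v\<in>K. if {v, w} \<in> E then 1 else 0)" by (rule sum.swap)
  also have "\<dots> = (\<Sum>w\<in>I. \<Sum>v\<in>K. if {w, v} \<in> E then 1 else 0)" by (simp only: insert_commute)
  also have "\<dots> = (\<Sum>v\<in>I. card (nbrs E v \<inter> K))" by (simp only: card_eq[OF assms(1)])
  finally show ?thesis .
qed

text \<open>Edges between \<open>K\<close> and \<open>I\<close> contribute equally to both degree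
  sums and cancel. The additive form avoids subtraction on naturals.\<close>

lemma sum_degree_partition:
  assumes graph: "simple_graph V E" and V: "K \<union> I = V" "K \<inter> I = {}"
  shows "(\<Sum>v\<in>K. degree E v) + (\<Sum>v\<in>I. card (nbrs E v \<inter> I)) =
    (\<Sum>v\<in>K. card (nbrs E v \<inter> K)) + (\<Sum>v\<in>I. degree E v)"
proof -
  have fin: "finite K" "finite I" using graph V by (auto simp: simple_graph_def)
  have "degree E v = card (nbrs E v \<inter> K) + card (nbrs E v \<inter> I)" for v
  proof -
    have "nbrs E v \<subseteq> K \<union> I" using nbrs_subset[OF graph, of v] V(1) by blast
    then have "nbrs E v = (nbrs E v \<inter> K) \<union> (nbrs E v \<inter> I)" by blast
    moreover have "(nbrs E v \<inter> K) \<inter> (nbrs E v \<inter> I) = {}" using V(2) by blast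
    ultimately show ?thesis
      using fin card_Un_disjoint[of "nbrs E v \<inter> K" "nbrs E v \<inter> I"]
      unfolding degree_eq_card_nbrs[OF graph] by simp
  qed
  then show ?thesis
    using sum_card_nbrs_swap[OF fin, of E] by (simp add: sum.distrib)
qed

text \<open>
  The difference between the degree sums over \<open>K\<close> and \<open>I\<close> is maximal exactly when \<open>K\<close> is a clique
  and \<open>I\<close> is independent.
\<close>

lemma split_partition_same_degrees:
  assumes E: "split_partition V K I E" and F: "F \<in> graphs_with_degrees V (degree E)"
  shows "split_partition V K I F"
proof -
  interpret split_partition V K I E by (fact E)
  have graphF: "simple_graph V F" and deg: "\<And>v. v \<in> V \<Longrightarrow> degree F v = degree E v"
    using F by (simp_all add: graphs_with_degrees_def)
  have fin: "finite K" "finite I" using graph Un by (auto simp: simple_graph_def)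
  have EI: "nbrs E v \<inter> I = {}" if "v \<in> I" for v
    using indep_edge that by auto
  have EK: "nbrs E v \<inter> K = K - {v}" if "v \<in> K" for v
    using clique_edge[of v] nbrs_subset[OF graph, of v] that by auto
  have FK: "nbrs F v \<inter> K \<subseteq> K - {v}" for v
    using nbrs_subset[OF graphF, of v] by blast
  have "(\<Sum>v\<in>K. degree F v) = (\<Sum>v\<in>K. degree E v)" "(\<Sum>v\<in>I. degree F v) = (\<Sum>v\<in>I. degree E v)"
    using deg Un by (auto intro!: sum.cong)
  then have eq: "(\<Sum>v\<in>K. card (nbrs F v \<inter> K)) = (\<Sum>v\<in>K. card (K - {v})) + (\<Sum>v\<in>I. card (nbrs F v \<inter> I))"
    using sum_degree_partition[OF graph Un disj] sum_degree_partition[OF graphF Un disj]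
    by (simp add: EI EK)
  have le: "card (nbrs F v \<inter> K) \<le> card (K - {v})" for v
    using fin FK by (intro card_mono) auto
  then have "(\<Sum>v\<in>K. card (nbrs F v \<inter> K)) \<le> (\<Sum>v\<in>K. card (K - {v}))" by (intro sum_mono)
  \<comment> \<open>The left side of \<open>eq\<close> is at most the first summand on its right, so
    the other summand vanishes and equality holds.\<close>
  with eq have I0: "(\<Sum>v\<in>I. card (nbrs F v \<inter> I)) = 0"
    and K0: "(\<Sum>v\<in>K. card (nbrs F v \<inter> K)) = (\<Sum>v\<in>K. card (K - {v}))" by linarith+
  have FI: "nbrs F v \<inter> I = {}" if "v \<in> I" for v
    using I0 fin that by simp
  have FK': "nbrs F v \<inter> K = K - {v}" if "v \<in> K" for v
  proof (rule card_subset_eq)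
    show "card (nbrs F v \<inter> K) = card (K - {v})"
    proof (rule ccontr)
      assume "card (nbrs F v \<inter> K) \<noteq> card (K - {v})"
      then have "card (nbrs F v \<inter> K) < card (K - {v})" using le[of v] by simp
      then have "(\<Sum>v\<in>K. card (nbrs F v \<inter> K)) < (\<Sum>v\<in>K. card (K - {v}))"
        by (intro sum_strict_mono_ex1) (use that fin le in blast)+
      then show False using K0 by simp
    qed
  qed (use fin FK in auto)
  show ?thesis
  proof
    have "w \<in> nbrs F v" if "v \<in> K" "w \<in> K" "v \<noteq> w" for v w
      using FK'[OF that(1)] that by blast
    then show "clique K F" by (simp add: clique_def)
    have "w \<notin> nbrs F v" if "v \<in> I" "w \<in> I" for v w
      using FI[OF that(1)] that by blast
    then show "indep I F" by (simp add: indep_def)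
  qed (fact graphF Un disj)+
qed

section \<open>Switching an induced path and its effect on the other induced paths\<close>

definition P4s :: "'a set \<Rightarrow> 'a set set \<Rightarrow> 'a set set" where
  "P4s V E = {S. induced_P4 V E S}"

lemma P4_reducible_cong: "P4s V E = P4s V F \<Longrightarrow> P4_reducible V E \<longleftrightarrow> P4_reducible V F"
  unfolding P4s_def P4_reducible_def set_eq_iff mem_Collect_eq by simp

text \<open>Of the four changes only the removal of \<open>p\<close> can create a new difference,
  while \<open>q\<close> and \<open>r\<close> cease to be differences, so the distance
  drops.\<close>

lemma exchange_closer:
  assumes "finite A" "finite B" "p \<in> A" "q \<in> A" "r \<notin> A" "s \<notin> A" "q \<notin> B" "r \<in> B" "s \<in> B"
  shows "card (flip (A - {p, q} \<union> {r, s}) B) < card (flip A B)"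
proof -
  have fin: "finite (flip A B)" using assms by (simp add: flip_def)
  have ne: "q \<noteq> r" using assms by blast
  have "flip (A - {p, q} \<union> {r, s}) B \<subseteq> insert p (flip A B - {q, r})"
    using assms by (auto simp: flip_def)
  then have "card (flip (A - {p, q} \<union> {r, s}) B) \<le> card (insert p (flip A B - {q, r}))"
    using fin by (intro card_mono) auto
  also have "\<dots> \<le> Suc (card (flip A B - {q, r}))" using card_insert_le_m1 by (simp add: card_insert_if fin)
  also have "card (flip A B - {q, r}) = card (flip A B) - card {q, r}"
    using assms by (intro card_Diff_subset) auto
  also have "Suc (card (flip A B) - card {q, r}) < card (flip A B)"
  proof -
    have "card {q, r} \<le> card (flip A B)" using assms fin by (intro card_mono) auto
    then show ?thesis using ne by simp
  qed
  finally show ?thesis .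
qed

context split_partition
begin

definition switched :: "'a \<Rightarrow> 'a \<Rightarrow> 'a \<Rightarrow> 'a \<Rightarrow> 'a set set" where
  "switched x y a b = E - {{x, a}, {y, b}} \<union> {{x, b}, {y, a}}"

lemma two_switch_switched: "alternating K I E x y a b \<Longrightarrow> two_switch E (switched x y a b)"
  unfolding two_switch_iff switched_def
  by (rule exI[of _ x], rule exI[of _ y], rule exI[of _ a], rule exI[of _ b], simp)

lemma switched_degrees:
  assumes "alternating K I E x y a b"
  shows "degree (switched x y a b) = degree E"
  using two_switch_degree[OF finite_edges[OF graph] two_switch_switched[OF assms]] by (rule ext)

lemma split_partition_switched:
  assumes "alternating K I E x y a b"
  shows "split_partition V K I (switched x y a b)"
proof (rule split_partition_same_degrees[OF split_partition_axioms])
  show "switched x y a b \<in> graphs_with_degrees V (degree E)"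
    using two_switch_simple_graph[OF graph two_switch_switched[OF assms]] switched_degrees[OF assms]
    by (simp add: graphs_with_degrees_def)
qed

lemma switched_edge_iff:
  assumes alt: "alternating K I E x y a b" and p: "p \<in> I" and u: "u \<in> K"
  shows "{p, u} \<in> switched x y a b \<longleftrightarrow> ({p, u} \<in> E) \<noteq> (p \<in> {x, y} \<and> u \<in> {a, b})"
proof -
  have eq: "{p, u} = {q, v} \<longleftrightarrow> p = q \<and> u = v" if "q \<in> I" "v \<in> K" for q v
    using p u that disj unfolding doubleton_eq_iff by blast
  have *: "{p, u} \<in> switched x y a b \<longleftrightarrow>
    {p, u} \<in> E \<and> \<not> (p = x \<and> u = a) \<and> \<not> (p = y \<and> u = b) \<or> p = x \<and> u = b \<or> p = y \<and> u = a"
    using alt unfolding switched_def alternating_def Un_iff Diff_iff insert_iff empty_iff by (metis eq)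
  have "x \<noteq> y" "a \<noteq> b" using alternating_distinct[OF alt] by simp_all
  then show ?thesis unfolding * using alt by (auto simp: alternating_def)
qed

lemma alternating_parts:
  assumes "alternating K I E x y a b"
  shows "{x, y, a, b} \<inter> I = {x, y}" "{x, y, a, b} \<inter> K = {a, b}"
  using assms disj by (auto simp: alternating_def)

lemma alternating_in_P4s: "alternating K I E x y a b \<Longrightarrow> {x, y, a, b} \<in> P4s V E"
  unfolding P4s_def mem_Collect_eq induced_P4_iff
  by (rule exI[of _ x], rule exI[of _ y], rule exI[of _ a], rule exI[of _ b], simp)

lemma P4sE:
  assumes "S \<in> P4s V E"
  obtains x y a b where "alternating K I E x y a b" "S = {x, y, a, b}"
  using assms unfolding P4s_def mem_Collect_eq induced_P4_iff by (elim exE conjE)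

lemma P4s_subset: "S \<in> P4s V E \<Longrightarrow> S \<subseteq> V"
  unfolding P4s_def mem_Collect_eq induced_P4_def by (elim exE conjE)

lemma finite_P4s: "finite (P4s V E)"
proof (rule finite_subset)
  show "P4s V E \<subseteq> Pow V" using P4s_subset by blast
  show "finite (Pow V)" using graph by (simp add: simple_graph_def)
qed

lemma P4s_meet:
  assumes "P4_reducible V E" "S \<in> P4s V E" "T \<in> P4s V E" "v \<in> S" "v \<in> T"
  shows "S = T"
proof -
  have "v \<in> V" using P4s_subset[OF assms(2)] assms(4) by blast
  with assms(1) show ?thesis
    unfolding P4_reducible_def using assms(2-5) by (simp add: P4s_def)
qed

text \<open>If \<open>u\<close> distinguished \<open>x\<close> from \<open>y\<close>, it could
  replace \<open>a\<close> or \<open>b\<close> and yield a second induced path through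
  \<open>x\<close>.\<close>

lemma alternating_same_row:
  assumes red: "P4_reducible V E" and alt: "alternating K I E x y a b" and u: "u \<in> K" "u \<notin> {a, b}"
  shows "{x, u} \<in> E \<longleftrightarrow> {y, u} \<in> E"
proof -
  have *: "c \<in> {x, y, a, b} \<and> c' \<in> {x, y, a, b}" if "alternating K I E x y c c'" for c c'
  proof -
    have "{x, y, c, c'} = {x, y, a, b}"
      by (rule P4s_meet[OF red alternating_in_P4s[OF that] alternating_in_P4s[OF alt], of x]) simp_all
    then show ?thesis by blast
  qed
  have u': "u \<notin> {x, y, a, b}" using u alt disj by (auto simp: alternating_def)
  show ?thesis
  proof
    assume "{x, u} \<in> E"
    show "{y, u} \<in> E"
    proof (rule ccontr)
      assume "{y, u} \<notin> E"
      then have "alternating K I E x y u b"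
        using \<open>{x, u} \<in> E\<close> alt u by (simp add: alternating_def)
      then show False using * u' by blast
    qed
  next
    assume "{y, u} \<in> E"
    show "{x, u} \<in> E"
    proof (rule ccontr)
      assume "{x, u} \<notin> E"
      then have "alternating K I E x y a u"
        using \<open>{y, u} \<in> E\<close> alt u by (simp add: alternating_def)
      then show False using * u' by blast
    qed
  qed
qed

text \<open>Paths that avoid \<open>x\<close> and \<open>y\<close> are unaffected by the exchange of
  these two vertices. A path that meets them is carried to one that still meets
  \<open>{x, y, a, b}\<close> and hence equals it, by reducibility.\<close>

lemma P4s_switched:
  assumes red: "P4_reducible V E" and alt: "alternating K I E x y a b"
  shows "P4s V (switched x y a b) = P4s V E"
proof -
  let ?F = "switched x y a b"
  interpret F: split_partition V K I ?F using alt by (rule split_partition_switched)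
  have S: "{x, y, a, b} \<in> P4s V E" using alt by (rule alternating_in_P4s)
  have altF: "alternating K I ?F x y b a"
    using alt by (simp add: alternating_def switched_edge_iff[OF alt])
  have xy: "x \<in> I" "y \<in> I" "x \<noteq> y" using alt alternating_distinct[OF alt] by (simp_all add: alternating_def)
  define \<sigma> where "\<sigma> p = (if p = x then y else if p = y then x else p)" for p
  \<comment> \<open>Since \<open>x\<close> and \<open>y\<close> agree off \<open>a\<close> and \<open>b\<close>, the switch amounts to exchanging \<open>x\<close> and \<open>y\<close>.\<close>
  have edge: "{p, u} \<in> ?F \<longleftrightarrow> {\<sigma> p, u} \<in> E" if "p \<in> I" "u \<in> K" for p u
  proof -
    have "{x, a} \<in> E" "{y, b} \<in> E" "{x, b} \<notin> E" "{y, a} \<notin> E" using alt by (simp_all add: alternating_def)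
    moreover have "u \<notin> {a, b} \<Longrightarrow> {x, u} \<in> E \<longleftrightarrow> {y, u} \<in> E"
      using alternating_same_row[OF red alt that(2)] .
    ultimately show ?thesis
      unfolding switched_edge_iff[OF alt that] \<sigma>_def using xy(3)
      by (cases "u = a"; cases "u = b"; cases "p = x"; cases "p = y") simp_all
  qed
  have \<sigma>I: "\<sigma> p \<in> I" if "p \<in> I" for p using that xy by (simp add: \<sigma>_def)
  show ?thesis
  proof (intro subset_antisym subsetI)
    fix T assume "T \<in> P4s V ?F"
    then obtain p q u v where *: "alternating K I ?F p q u v" "T = {p, q, u, v}" by (rule F.P4sE)
    then have pq: "p \<in> I" "q \<in> I" "u \<in> K" "v \<in> K" by (simp_all add: alternating_def)
    have altE: "alternating K I E (\<sigma> p) (\<sigma> q) u v"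
      using *(1) pq \<sigma>I by (simp add: alternating_def edge)
    show "T \<in> P4s V E"
    proof (cases "p \<in> {x, y} \<or> q \<in> {x, y}")
      case False
      then have "\<sigma> p = p" "\<sigma> q = q" by (auto simp: \<sigma>_def)
      then show ?thesis using alternating_in_P4s[OF altE] unfolding *(2) by simp
    next
      case True
      then have "\<sigma> p \<in> {x, y} \<or> \<sigma> q \<in> {x, y}" by (auto simp: \<sigma>_def)
      then obtain w where w: "w \<in> {\<sigma> p, \<sigma> q, u, v}" "w \<in> {x, y, a, b}" by blast
      have eq: "{\<sigma> p, \<sigma> q, u, v} = {x, y, a, b}"
        by (rule P4s_meet[OF red alternating_in_P4s[OF altE] S w])
      have "{\<sigma> p, \<sigma> q} = {x, y}" "{u, v} = {a, b}"
        using alternating_parts[OF altE] alternating_parts[OF alt] unfolding eq by simp_all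
      then have "{p, q} = {x, y}" using xy(3) by (auto simp: \<sigma>_def doubleton_eq_iff split: if_splits)
      moreover have "T = {p, q} \<union> {u, v}" unfolding *(2) by auto
      ultimately have "T = {x, y} \<union> {a, b}" using \<open>{u, v} = {a, b}\<close> by (simp only:)
      also have "\<dots> = {x, y, a, b}" by auto
      finally show ?thesis using S by (simp only:)
    qed
  next
    fix T assume T: "T \<in> P4s V E"
    then obtain p q u v where *: "alternating K I E p q u v" "T = {p, q, u, v}" by (rule P4sE)
    show "T \<in> P4s V ?F"
    proof (cases "p \<in> {x, y} \<or> q \<in> {x, y}")
      case True
      then obtain w where "w \<in> T" "w \<in> {x, y, a, b}" unfolding *(2) by blast
      then have "T = {x, y, a, b}" by (rule P4s_meet[OF red T S])
      then show ?thesis using F.alternating_in_P4s[OF altF] by (simp add: insert_commute)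
    next
      case False
      then have "\<sigma> p = p" "\<sigma> q = q" by (auto simp: \<sigma>_def)
      then have "alternating K I ?F p q u v"
        using *(1) by (simp add: alternating_def edge)
      then show ?thesis unfolding *(2) by (rule F.alternating_in_P4s)
    qed
  qed
qed

end

section \<open>Approaching a prescribed realization by switches\<close>

lemma nbrs_balance:
  assumes "simple_graph V E" "simple_graph V F" "degree E v = degree F v" "{v, w} \<in> E" "{v, w} \<notin> F"
  obtains u where "{v, u} \<in> F" "{v, u} \<notin> E"
proof -
  have "\<not> nbrs F v \<subset> nbrs E v"
    using psubset_card_mono[OF finite_nbrs[OF assms(1)], of "nbrs F v" v] assms(3)
    unfolding degree_eq_card_nbrs[OF assms(1)] degree_eq_card_nbrs[OF assms(2)] by auto
  moreover have "w \<in> nbrs E v" "w \<notin> nbrs F v" using assms by simp_all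
  ultimately obtain u where "u \<in> nbrs F v" "u \<notin> nbrs E v" by blast
  then show ?thesis using that by simp
qed

lemma simple_graph_edge_cases:
  assumes "simple_graph V E" "e \<in> E"
  obtains v w where "e = {v, w}" "v \<in> V" "w \<in> V"
proof -
  have "e \<subseteq> V" "card e = 2" using assms unfolding simple_graph_def nsets_def by blast+
  then obtain v w where "e = {v, w}" unfolding card_2_iff by blast
  then show ?thesis using that[of v w] \<open>e \<subseteq> V\<close> by simp
qed

context split_partition
begin

text \<open>
  Among the vertices of \<open>I\<close> at which the two graphs differ, one of largest degree lies on an
  induced path whose switch brings \<open>E\<close> closer to \<open>F\<close>.
\<close>

lemma closer_alternating:
  assumes red: "P4_reducible V E" and F: "F \<in> graphs_with_degrees V (degree E)" and "F \<noteq> E"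
  obtains x y a b where "alternating K I E x y a b"
    "{x, b} \<in> F" "{y, b} \<notin> F" "{y, a} \<in> F"
proof -
  interpret F: split_partition V K I F
    using split_partition_axioms F by (rule split_partition_same_degrees)
  have deg: "degree F v = degree E v" if "v \<in> V" for v
    using F that by (simp add: graphs_with_degrees_def)
  have IV: "v \<in> V" if "v \<in> I" for v using Un that by blast
  have KV: "v \<in> V" if "v \<in> K" for v using Un that by blast
  \<comment> \<open>By \<open>out\<close> below, a vertex of \<open>I\<close> that loses an edge
    also gains one, so \<open>T\<close> contains every vertex of \<open>I\<close> where
    \<open>E\<close> and \<open>F\<close> differ.\<close>
  define T where "T = {x \<in> I. \<exists>b\<in>K. {x, b} \<in> F \<and> {x, b} \<notin> E}"
  have out: "p \<in> T" if p: "p \<in> I" "{p, w} \<in> E" "{p, w} \<notin> F" for p w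
  proof -
    obtain u where u: "{p, u} \<in> F" "{p, u} \<notin> E"
      using nbrs_balance[OF graph F.graph deg[OF IV[OF p(1)], symmetric] p(2,3)] .
    then have "u \<in> K" using F.indep_edge[OF p(1)] simple_graph_edgeD[OF F.graph u(1)] Un by blast
    then show ?thesis using u p(1) unfolding T_def by blast
  qed
  \<comment> \<open>The degree of \<open>b\<close> is balanced as well: an edge gained at
    \<open>b\<close> is paid for by an edge lost there.\<close>
  have in_other: "\<exists>y\<in>T. {y, b} \<in> E \<and> {y, b} \<notin> F" if b: "b \<in> K" "{x, b} \<in> F" "{x, b} \<notin> E" for x b
  proof -
    have rev: "{b, x} = {x, b}" by auto
    obtain y where y: "{b, y} \<in> E" "{b, y} \<notin> F"
      using nbrs_balance[OF F.graph graph deg[OF KV[OF b(1)]], of x] b(2,3) unfolding rev .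
    have "y \<in> V" "b \<noteq> y" using simple_graph_edgeD[OF graph y(1)] by simp_all
    then have "y \<in> I" using F.clique_edge[OF b(1)] y(2) Un by blast
    have rev': "{b, y} = {y, b}" by auto
    show ?thesis using y out[OF \<open>y \<in> I\<close>] unfolding rev' by blast
  qed
  have "finite T" using graph Un by (auto simp: T_def simple_graph_def)
  have "T \<noteq> {}"
  proof -
    have "\<exists>v u. v \<in> V \<and> {v, u} \<in> F \<and> {v, u} \<notin> E"
    proof (cases "F \<subseteq> E")
      case False
      then obtain e where e: "e \<in> F" "e \<notin> E" by blast
      obtain v u where "e = {v, u}" "v \<in> V" using F.graph e(1) by (rule simple_graph_edge_cases)
      then show ?thesis using e by blast
    next
      case True
      then obtain e where e: "e \<in> E" "e \<notin> F" using \<open>F \<noteq> E\<close> by blast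
      obtain v w where vw: "e = {v, w}" "v \<in> V" using graph e(1) by (rule simple_graph_edge_cases)
      obtain u where "{v, u} \<in> F" "{v, u} \<notin> E"
        using nbrs_balance[OF graph F.graph deg[OF vw(2), symmetric], of w] e unfolding vw(1) .
      then show ?thesis using vw(2) by blast
    qed
    then obtain v u where vu: "{v, u} \<in> F" "{v, u} \<notin> E" by blast
    have ne: "v \<noteq> u" "v \<in> V" "u \<in> V" using simple_graph_edgeD[OF F.graph vu(1)] by simp_all
    have rev: "{u, v} = {v, u}" by auto
    show ?thesis
    proof (cases "v \<in> K")
      case True
      then have "u \<in> I" using clique_edge[of v u] vu(2) ne Un by blast
      then show ?thesis using vu True unfolding T_def rev[symmetric] by blast
    next
      case False
      then have "v \<in> I" using ne Un by blast
      moreover from this have "u \<in> K" using F.indep_edge[of v u] vu(1) ne Un by blast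
      ultimately show ?thesis using vu unfolding T_def by blast
    qed
  qed
  \<comment> \<open>The vertex \<open>q\<close> that loses \<open>c\<close> has degree at most that
    of \<open>p\<close> and is adjacent to \<open>c\<close>, unlike \<open>p\<close>; hence
    \<open>p\<close> has a neighbour \<open>a\<close> that \<open>q\<close> lacks, which closes the
    alternating quadruple.\<close>
  have partner: "\<exists>q a. q \<in> T \<and> alternating K I E p q a c \<and> {q, c} \<notin> F"
    if p: "p \<in> I" and max: "\<And>q. q \<in> T \<Longrightarrow> degree E q \<le> degree E p"
      and c: "c \<in> K" "{p, c} \<in> F" "{p, c} \<notin> E" for p c
  proof -
    obtain q where q: "q \<in> T" "{q, c} \<in> E" "{q, c} \<notin> F" using in_other[OF c] by blast
    have "q \<in> I" using q(1) by (simp add: T_def)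
    have "\<not> nbrs E p \<subset> nbrs E q"
      using psubset_card_mono[OF finite_nbrs[OF graph], of "nbrs E p" q] max[OF q(1)]
      unfolding degree_eq_card_nbrs[OF graph] by auto
    moreover have "c \<in> nbrs E q" "c \<notin> nbrs E p" using c q by simp_all
    ultimately obtain a where "a \<in> nbrs E p" "a \<notin> nbrs E q" by blast
    then have a: "{p, a} \<in> E" "{q, a} \<notin> E" by simp_all
    then have "a \<in> K" using indep_edge[OF p, of a] simple_graph_edgeD[OF graph a(1)] Un by blast
    then have "alternating K I E p q a c"
      using p \<open>q \<in> I\<close> a c q by (simp add: alternating_def)
    then show ?thesis using q by blast
  qed
  obtain x where x: "x \<in> T" and max: "\<And>q. q \<in> T \<Longrightarrow> degree E q \<le> degree E x"
    using finite_has_max_weight[OF \<open>finite T\<close> \<open>T \<noteq> {}\<close>, of "degree E"] by blast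
  then obtain b where b: "x \<in> I" "b \<in> K" "{x, b} \<in> F" "{x, b} \<notin> E" unfolding T_def by blast
  obtain y a where y: "y \<in> T" and alt: "alternating K I E x y a b" and yb: "{y, b} \<notin> F"
    using partner[OF b(1) max b(2-4)] by blast
  have E4: "{x, a} \<in> E" "{y, b} \<in> E" "{x, b} \<notin> E" "{y, a} \<notin> E" "a \<in> K" "y \<in> I"
    using alt by (simp_all add: alternating_def)
  \<comment> \<open>\<open>x\<close> and \<open>y\<close> agree outside \<open>a\<close> and
    \<open>b\<close>, so they have equal degree and \<open>y\<close> is of largest degree in
    \<open>T\<close> too.\<close>
  have "nbrs E y = insert b (nbrs E x - {a})"
  proof (rule set_eqI)
    fix u
    consider "u = a" | "u = b" | "u \<in> K" "u \<notin> {a, b}" | "u \<in> I" | "u \<notin> V" using Un by blast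
    then show "u \<in> nbrs E y \<longleftrightarrow> u \<in> insert b (nbrs E x - {a})"
    proof cases
      case 3
      then show ?thesis using alternating_same_row[OF red alt 3] by simp
    next
      case 4
      then show ?thesis
        using indep_edge[OF b(1) 4] indep_edge[OF E4(6) 4] b(2) disj by auto
    next
      case 5
      then show ?thesis
        using simple_graph_edgeD(2)[OF graph, of x u] simple_graph_edgeD(2)[OF graph, of y u] KV[OF b(2)] by auto
    qed (use E4 in auto)
  qed
  moreover have "card (insert b (nbrs E x - {a})) = card (nbrs E x)"
    using finite_nbrs[OF graph, of x] E4 card.remove[of "nbrs E x" a] by simp
  ultimately have "degree E y = degree E x" by (simp add: degree_eq_card_nbrs[OF graph])
  then have max_y: "degree E q \<le> degree E y" if "q \<in> T" for q using max[OF that] by simp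
  \<comment> \<open>Applying \<open>partner\<close> to \<open>y\<close> and an edge
    \<open>yc\<close> that it gains produces an induced path through \<open>y\<close>. Reducibility
    makes it the old one, which forces \<open>c = a\<close>.\<close>
  obtain c where c: "c \<in> K" "{y, c} \<in> F" "{y, c} \<notin> E" using y unfolding T_def by blast
  obtain z a' where "alternating K I E y z a' c"
    using partner[OF E4(6) max_y c] by blast
  then have alt': "{y, z, a', c} \<in> P4s V E" by (rule alternating_in_P4s)
  have "{y, z, a', c} = {x, y, a, b}"
    by (rule P4s_meet[OF red alt' alternating_in_P4s[OF alt], of y]) simp_all
  then have "c \<in> {x, y, a, b}" by blast
  then have "c = a" using c E4 b disj by auto
  then show ?thesis using that alt b(3) yb c(2) by blast
qed

end

text \<open>Induction on the number of differences with \<open>F\<close> fixed: replacing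
  \<open>E\<close> by a closer switched graph changes neither the family of induced paths nor,
  therefore, reducibility.\<close>

lemma P4s_same_degrees:
  assumes "split_partition V K I E" "P4_reducible V E" "F \<in> graphs_with_degrees V (degree E)"
  shows "P4s V F = P4s V E"
  using assms
proof (induction "card (flip E F)" arbitrary: E rule: less_induct)
  case less
  interpret split_partition V K I E by (fact less.prems(1))
  show ?case
  proof (cases "F = E")
    case False
    then obtain x y a b where alt: "alternating K I E x y a b" and F: "{x, b} \<in> F" "{y, b} \<notin> F" "{y, a} \<in> F"
      using closer_alternating[OF less.prems(2,3)] by blast
    have "simple_graph V F" using less.prems(3) by (simp add: graphs_with_degrees_def)
    then have "card (flip (switched x y a b) F) < card (flip E F)"
      unfolding switched_def using finite_edges graph alt F
      by (intro exchange_closer) (simp_all add: alternating_def)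
    then have "P4s V F = P4s V (switched x y a b)"
    proof (rule less.hyps)
      show "split_partition V K I (switched x y a b)" using alt by (rule split_partition_switched)
      show "P4_reducible V (switched x y a b)"
        using P4_reducible_cong[OF P4s_switched[OF less.prems(2) alt]] less.prems(2) by simp
      show "F \<in> graphs_with_degrees V (degree (switched x y a b))"
        using less.prems(3) by (simp add: switched_degrees[OF alt])
    qed
    then show ?thesis using P4s_switched[OF less.prems(2) alt] by simp
  qed simp
qed

section \<open>The hypercube of switched paths\<close>

text \<open>An enumeration of \<open>P\<close> turns subsets into characteristic bit vectors, and
  the size of a symmetric difference into the Hamming distance.\<close>

lemma hypercube_if_bij_Pow:
  assumes "finite P" and g: "bij_betw g R (Pow P)"
    and adj: "\<And>F G. F \<in> R \<Longrightarrow> G \<in> R \<Longrightarrow> {F, G} \<in> Ed \<longleftrightarrow> card (flip (g F) (g G)) = 1"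
  shows "hypercube R Ed"
proof -
  define m where "m = card P"
  obtain h where h: "bij_betw h {0..<m} P"
    using ex_bij_betw_nat_finite[OF \<open>finite P\<close>] unfolding m_def by blast
  define bits where "bits A = map (\<lambda>i. h i \<in> A) [0..<m]" for A
  have hP: "h i \<in> P" if "i < m" for i using bij_betwE[OF h] that by simp
  have Ph: "\<exists>i<m. S = h i" if "S \<in> P" for S
    using h that unfolding bij_betw_def by (metis atLeastLessThan_iff imageE)
  have "bij_betw bits (Pow P) {xs. length xs = m}"
  proof (rule bij_betwI[where g = "\<lambda>xs. {h i | i. i < m \<and> xs ! i}"])
    show "bits \<in> Pow P \<rightarrow> {xs. length xs = m}" by (simp add: bits_def)
    show "(\<lambda>xs. {h i |i. i < m \<and> xs ! i}) \<in> {xs. length xs = m} \<rightarrow> Pow P" using hP by auto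
    show "{h i |i. i < m \<and> bits A ! i} = A" if A: "A \<in> Pow P" for A
    proof (intro subset_antisym subsetI)
      fix S assume "S \<in> A"
      then obtain i where "i < m" "S = h i" using A Ph by blast
      then show "S \<in> {h i |i. i < m \<and> bits A ! i}" using \<open>S \<in> A\<close> by (auto simp: bits_def)
    qed (auto simp: bits_def)
    show "bits {h i |i. i < m \<and> xs ! i} = xs" if "xs \<in> {xs. length xs = m}" for xs
    proof (rule nth_equalityI)
      fix i assume "i < length (bits {h i |i. i < m \<and> xs ! i})"
      then have "i < m" by (simp add: bits_def)
      have "h i = h j \<longleftrightarrow> i = j" if "j < m" for j
        using bij_betw_imp_inj_on[OF h] \<open>i < m\<close> that by (simp add: inj_on_eq_iff)
      then show "bits {h i |i. i < m \<and> xs ! i} ! i = xs ! i"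
        using \<open>i < m\<close> by (auto simp: bits_def)
    qed (use that in \<open>simp add: bits_def\<close>)
  qed
  with g have bij: "bij_betw (bits \<circ> g) R {xs. length xs = m}" by (rule bij_betw_trans)
  have "card {i. i < m \<and> (bits \<circ> g) F ! i \<noteq> (bits \<circ> g) G ! i} = card (flip (g F) (g G))"
    if "F \<in> R" "G \<in> R" for F G
  proof -
    let ?D = "{i. i < m \<and> (bits \<circ> g) F ! i \<noteq> (bits \<circ> g) G ! i}"
    have sub: "g F \<subseteq> P" "g G \<subseteq> P" using bij_betwE[OF g] that by auto
    have "h ` ?D = flip (g F) (g G)"
    proof (rule set_eqI)
      fix S
      show "S \<in> h ` ?D \<longleftrightarrow> S \<in> flip (g F) (g G)"
      proof
        assume "S \<in> h ` ?D"
        then show "S \<in> flip (g F) (g G)" by (auto simp: bits_def)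
      next
        assume S: "S \<in> flip (g F) (g G)"
        then have "S \<in> P" using sub by auto
        then obtain i where "i < m" "S = h i" using Ph by blast
        with S show "S \<in> h ` ?D" by (simp add: bits_def)
      qed
    qed
    moreover have "inj_on h ?D"
      using bij_betw_imp_inj_on[OF h] by (rule inj_on_subset) auto
    ultimately show ?thesis by (metis card_image)
  qed
  then show ?thesis
    unfolding hypercube_def using bij adj by (intro exI[of _ m] exI[of _ "bits \<circ> g"]) simp
qed

text \<open>\<open>g\<close> codes a graph by a subset of \<open>P\<close>. Since \<open>up\<close>
  realizes every single flip, repeated flips from one graph reach all of \<open>Pow P\<close>. One
  direction of adjacency is \<open>down\<close>; for the other, \<open>inj\<close> identifies the
  graph supplied by \<open>up\<close> with the given one.\<close>

lemma switch_hypercube_if_flips: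
  assumes "finite P" "R \<noteq> {}" and sub: "\<And>F. F \<in> R \<Longrightarrow> g F \<subseteq> P" and inj: "inj_on g R"
    and up: "\<And>F S. F \<in> R \<Longrightarrow> S \<in> P \<Longrightarrow> \<exists>G\<in>R. two_switch F G \<and> g G = flip (g F) {S}"
    and down: "\<And>F G. F \<in> R \<Longrightarrow> two_switch F G \<Longrightarrow> \<exists>S\<in>P. g G = flip (g F) {S}"
  shows "hypercube R (switch_edges R)"
proof (rule hypercube_if_bij_Pow)
  obtain F0 where "F0 \<in> R" using \<open>R \<noteq> {}\<close> by blast
  have reach: "\<exists>F\<in>R. g F = flip (g F0) D" if "finite D" "D \<subseteq> P" for D
    using that
  proof (induction D rule: finite_induct)
    case empty
    show ?case using \<open>F0 \<in> R\<close> by auto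
  next
    case (insert S D)
    then obtain F where F: "F \<in> R" "g F = flip (g F0) D" by auto
    obtain G where G: "G \<in> R" "g G = flip (g F) {S}" using up[OF F(1), of S] insert.prems by auto
    have "flip D {S} = insert S D" using insert.hyps by (auto simp: flip_def)
    then have "g G = flip (g F0) (insert S D)" using F G by (simp add: flip_flip)
    then show ?case using G by blast
  qed
  have "A \<in> g ` R" if "A \<subseteq> P" for A
  proof -
    \<comment> \<open>Flipping the difference between \<open>g F0\<close> and \<open>A\<close>
      arrives at \<open>A\<close>.\<close>
    have "flip (g F0) A \<subseteq> P" using that sub[OF \<open>F0 \<in> R\<close>] by (auto simp: flip_def)
    then obtain F where "F \<in> R" "g F = flip (g F0) (flip (g F0) A)"
      using reach finite_subset[OF _ \<open>finite P\<close>] by blast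
    moreover have "flip (g F0) (flip (g F0) A) = A" by (auto simp: flip_def)
    ultimately show ?thesis by (metis imageI)
  qed
  then show "bij_betw g R (Pow P)" using inj sub by (auto simp: bij_betw_def)
  fix F G assume FG: "F \<in> R" "G \<in> R"
  show "{F, G} \<in> switch_edges R \<longleftrightarrow> card (flip (g F) (g G)) = 1"
    unfolding switch_edges_iff[OF FG]
  proof
    assume "two_switch F G"
    then obtain S where "g G = flip (g F) {S}" using down[OF FG(1)] by blast
    then have "flip (g F) (g G) = {S}" by (auto simp: flip_def)
    then show "card (flip (g F) (g G)) = 1" by simp
  next
    assume "card (flip (g F) (g G)) = 1"
    then obtain S where S: "flip (g F) (g G) = {S}" by (rule card_1_singletonE)
    have "flip (g F) (flip (g F) (g G)) = g G" by (auto simp: flip_def)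
    then have gG: "flip (g F) {S} = g G" unfolding S .
    have "flip (g F) (g G) \<subseteq> P" using sub[OF FG(1)] sub[OF FG(2)] by (auto simp: flip_def)
    then have "S \<in> P" unfolding S by simp
    then obtain G' where G': "G' \<in> R" "two_switch F G'" "g G' = g G" using up[OF FG(1)] gG by metis
    then have "G' = G" using inj FG(2) by (metis inj_onD)
    then show "two_switch F G" using G'(2) by simp
  qed
qed (fact \<open>finite P\<close>)

lemma split_P4_reducible_imp_hypercube:
  assumes split: "split_graph V E" and red: "P4_reducible V E" and E: "E \<in> graphs_with_degrees V g"
  shows "hypercube (graphs_with_degrees V g) (switch_edges (graphs_with_degrees V g))"
proof -
  define R where "R = graphs_with_degrees V g"
  have graph: "simple_graph V E" using E by (simp add: graphs_with_degrees_def)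
  obtain K I where sp: "split_partition V K I E"
    using split graph unfolding split_graph_def split_partition_def by blast
  interpret E: split_partition V K I E by (fact sp)
  define P where "P = P4s V E"
  have R_eq: "R = graphs_with_degrees V (degree F)" if "F \<in> R" for F
    using that unfolding R_def graphs_with_degrees_def by simp
  have "E \<in> R" using E by (simp add: R_def)
  have spF: "split_partition V K I F" and P4sF: "P4s V F = P" if "F \<in> R" for F
    using split_partition_same_degrees[OF sp] P4s_same_degrees[OF sp red] that R_eq[OF \<open>E \<in> R\<close>]
    unfolding P_def by blast+
  have redF: "P4_reducible V F" if "F \<in> R" for F
    using P4_reducible_cong[of V F E] P4sF[OF that] red by (simp add: P_def)
  \<comment> \<open>One vertex on each side of every path is chosen, once for all realizations.
    Whether these two are adjacent tells which of its two states the path is in.\<close>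
  have "\<exists>x a. x \<in> S \<and> x \<in> I \<and> a \<in> S \<and> a \<in> K" if S: "S \<in> P" for S
  proof -
    obtain x y a b where "alternating K I E x y a b" "S = {x, y, a, b}"
      using S unfolding P_def by (rule E.P4sE)
    then show ?thesis by (auto simp: alternating_def)
  qed
  then obtain px pa where px: "\<And>S. S \<in> P \<Longrightarrow> px S \<in> S \<and> px S \<in> I \<and> pa S \<in> S \<and> pa S \<in> K"
    by metis
  define bit where "bit F = {S \<in> P. {px S, pa S} \<in> F}" for F
  \<comment> \<open>Other paths are disjoint from the switched one, so only its own bit
    changes.\<close>
  have bit_switched: "bit (split_partition.switched F x y a b) = flip (bit F) {{x, y, a, b}}"
    if F: "F \<in> R" and alt: "alternating K I F x y a b" for F x y a b
  proof -
    interpret F: split_partition V K I F using F by (rule spF)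
    have S: "{x, y, a, b} \<in> P" using F.alternating_in_P4s[OF alt] P4sF[OF F] by simp
    have "T \<in> bit (F.switched x y a b) \<longleftrightarrow> T \<in> flip (bit F) {{x, y, a, b}}" if T: "T \<in> P" for T
    proof -
      have "px T \<in> {x, y} \<and> pa T \<in> {a, b} \<longleftrightarrow> T = {x, y, a, b}"
      proof
        assume "px T \<in> {x, y} \<and> pa T \<in> {a, b}"
        then have "px T \<in> {x, y, a, b}" by blast
        then show "T = {x, y, a, b}"
          using px[OF T] S T P4sF[OF F] F.P4s_meet[OF redF[OF F], of T "{x, y, a, b}" "px T"] by simp
      next
        assume "T = {x, y, a, b}"
        then have "px T \<in> {x, y, a, b} \<inter> I" "pa T \<in> {x, y, a, b} \<inter> K" using px[OF T] by simp_all
        then show "px T \<in> {x, y} \<and> pa T \<in> {a, b}" unfolding F.alternating_parts[OF alt] by blast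
      qed
      then show ?thesis
        using T F.switched_edge_iff[OF alt, of "px T" "pa T"] px[OF T] by (simp add: bit_def)
    qed
    moreover have "bit (F.switched x y a b) \<subseteq> P" "flip (bit F) {{x, y, a, b}} \<subseteq> P"
      using S unfolding bit_def flip_def by blast+
    ultimately show ?thesis by (meson subset_antisym subset_iff)
  qed
  have closed: "G \<in> R" if "F \<in> R" "two_switch F G" for F G
    using that unfolding R_def by (rule two_switch_graphs_with_degrees)
  have "hypercube R (switch_edges R)"
  proof (rule switch_hypercube_if_flips[of P R bit])
    show "finite P" unfolding P_def by (rule E.finite_P4s)
    show "R \<noteq> {}" using \<open>E \<in> R\<close> by blast
    show "bit F \<subseteq> P" for F by (auto simp: bit_def)
    show "inj_on bit R"
    proof (rule inj_onI, rule ccontr)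
      fix F F' assume FF: "F \<in> R" "F' \<in> R" "bit F = bit F'" "F \<noteq> F'"
      interpret F: split_partition V K I F using FF(1) by (rule spF)
      interpret F': split_partition V K I F' using FF(2) by (rule spF)
      \<comment> \<open>\<open>closer_alternating\<close> yields a path that has opposite states in
        \<open>F\<close> and \<open>F'\<close>, so the two codes differ at it.\<close>
      obtain x y a b where alt: "alternating K I F x y a b" and F': "{x, b} \<in> F'" "{y, b} \<notin> F'" "{y, a} \<in> F'"
        using F.closer_alternating[OF redF[OF FF(1)], of F'] FF R_eq[OF FF(1)] by metis
      define S where "S = {x, y, a, b}"
      have "S \<in> P" using F.alternating_in_P4s[OF alt] P4sF[OF FF(1)] by (simp add: S_def)
      then have "S \<in> P4s V F'" using P4sF[OF FF(2)] by simp
      then obtain x' y' a' b' where alt': "alternating K I F' x' y' a' b'" "S = {x', y', a', b'}"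
        by (rule F'.P4sE)
      have xy: "{x', y'} = {x, y}" "{a', b'} = {a, b}"
        using F.alternating_parts[OF alt] F'.alternating_parts[OF alt'(1)]
        unfolding S_def[symmetric] alt'(2)[symmetric] by simp_all
      \<comment> \<open>\<open>S\<close> is alternating in \<open>F'\<close> too, and its state
        there is the one with the edges \<open>xb\<close> and \<open>ya\<close>.\<close>
      then have "{x, a} \<notin> F'"
        using alt'(1) F' unfolding doubleton_eq_iff by (auto simp: alternating_def)
      then have differ: "{p, u} \<in> F \<longleftrightarrow> {p, u} \<notin> F'" if "p \<in> {x, y}" "u \<in> {a, b}" for p u
        using that F' alt by (auto simp: alternating_def)
      have "px S \<in> S \<inter> I" "pa S \<in> S \<inter> K" using px[OF \<open>S \<in> P\<close>] by simp_all
      then have "px S \<in> {x, y}" "pa S \<in> {a, b}"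
        unfolding S_def F.alternating_parts[OF alt] .
      then have "S \<in> bit F \<longleftrightarrow> S \<notin> bit F'" using differ \<open>S \<in> P\<close> by (simp add: bit_def)
      then show False using FF(3) by simp
    qed
  next
    fix F S assume F: "F \<in> R" and S: "S \<in> P"
    interpret F: split_partition V K I F using F by (rule spF)
    have "S \<in> P4s V F" using S P4sF[OF F] by simp
    then obtain x y a b where alt: "alternating K I F x y a b" "S = {x, y, a, b}" by (rule F.P4sE)
    have ts: "two_switch F (F.switched x y a b)" using alt(1) by (rule F.two_switch_switched)
    show "\<exists>G\<in>R. two_switch F G \<and> bit G = flip (bit F) {S}"
      using closed[OF F ts] ts bit_switched[OF F alt(1)] unfolding alt(2) by blast
  next
    fix F G assume F: "F \<in> R" and "two_switch F G"
    interpret F: split_partition V K I F using F by (rule spF)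
    obtain x y a b where alt: "alternating K I F x y a b" "G = F.switched x y a b"
      using \<open>two_switch F G\<close> unfolding F.two_switch_iff F.switched_def[symmetric] by (elim exE conjE)
    have "{x, y, a, b} \<in> P" using F.alternating_in_P4s[OF alt(1)] P4sF[OF F] by simp
    then show "\<exists>S\<in>P. bit G = flip (bit F) {S}" using bit_switched[OF F alt(1)] unfolding alt(2) by blast
  qed
  then show ?thesis unfolding R_def .
qed

theorem theorem4p4:
  fixes d :: "nat list"
  assumes "realizations d \<noteq> {}"
  shows "hypercube (realizations d) (realization_graph_edges d) \<longleftrightarrow>
    (\<exists>E\<in>realizations d. split_graph (seq_verts d) E \<and> P4_reducible (seq_verts d) E)"
proof -
  have R: "realizations d = graphs_with_degrees (seq_verts d) (\<lambda>i. d ! (i - 1))"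
    by (simp add: realizations_def graphs_with_degrees_def)
  have Ed: "realization_graph_edges d = switch_edges (realizations d)"
    by (simp add: realization_graph_edges_def switch_edges_def)
  \<comment> \<open>\<open>assms\<close> provides a realization to which the forward implication
    applies; there every realization qualifies, while backwards a single one suffices.\<close>
  show ?thesis
    using assms hypercube_imp_split_P4_reducible split_P4_reducible_imp_hypercube
    unfolding R Ed by blast
qed

end
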